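(* Let $X=\{x,y\}$ with $|x|=\bar 1$ and $|y|=\bar 0$. There exists a homomorphic image of the superalgebra $ST(\{x,y\})$ which is exceptional.
   Context: All (super)algebras are over a field $\mathbb K$ of characteristic $0$; a superalgebra is a $\mathbb Z_2$-graded algebra, and $|a|$ denotes the parity of a homogeneous element $a$. A Zinbiel superalgebra is a superalgebra whose product satisfies $a(bc)=(ab)c+(-1)^{|a||b|}(ba)c$ for all homogeneous $a,b,c$. For a Zinbiel superalgebra $A$, $A^{(-)}$ denotes the superalgebra $(A,[\cdot,\cdot])$ with $[a,b]=ab-(-1)^{|a||b|}ba$. A Tortkara superalgebra is a superalgebra satisfying, for all homogeneous $a,b,c,d$, $ab=-(-1)^{|a||b|}ba$ and $$(ab)(cd)-(-1)^{|d|(|b|+|c|)}(ad)(bc)=J_s(a,b,c)d+(-1)^{|a||b|}b\,J_s(a,c,d),$$ where $J_s(x,y,z)=(xy)z-x(yz)-(-1)^{|y||z|}(xz)y$. A Tortkara superalgebra $T$ is called special if there exists a Zinbiel superalgebra $A$ such that $T$ is (isomorphic to) a sub-superalgebra of $A^{(-)}$; otherwise it is called exceptional. $\mathrm{Zin}(X)$ denotes the free Zinbiel superalgebra on the set $X$ of even and odd generators, and $ST(X)$ (the free special Tortkara superalgebra on $X$) denotes the sub-superalgebra of $\mathrm{Zin}(X)^{(-)}$ generated by $X$. A homomorphic image of $ST(X)$ is a quotient by a ($\mathbb Z_2$-graded) ideal. *)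

theory Defs
  imports
    "HOL-Algebra.Module"
    "HOL-Algebra.QuotRing"
    "HOL-Algebra.Algebraic_Closure_Type"
    "HOL-Library.Poly_Mapping"
    "HOL-Library.Z2"
    "HOL.Hull"
begin

section \<open>Superalgebras\<close>

text \<open>
  The ground field is an arbitrary type of class \<^class>\<open>field_char_0\<close>, seen as a ring record so
  that the carrier-based modules of HOL-Algebra can be used. Parities are elements of the
  field \<^typ>\<open>bit\<close> of integers mod 2.

  The product of a superalgebra is the \<^const>\<open>monoid.mult\<close> field of the module record. It is neither
  associative nor unital: the \<^const>\<open>one\<close> field of the record is never used.
\<close>

abbreviation scalars :: "'k::field_char_0 ring" where
  "scalars \<equiv> ring_of_type_algebra"

record ('k, 'a) superalgebra = "('k, 'a) module" +
  homog :: "bit \<Rightarrow> 'a set"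

locale superalgebra = module scalars A
  for A :: "('k::field_char_0, 'a) superalgebra" (structure) +
  assumes homog_submodule: "submodule (homog A i) scalars A"
    and homog_span: "carrier A = homog A 0 <+>\<^bsub>A\<^esub> homog A 1"
    and homog_Int: "homog A 0 \<inter> homog A 1 = {\<zero>}"
    and prod_homog: "\<lbrakk>a \<in> homog A i; b \<in> homog A j\<rbrakk> \<Longrightarrow> a \<otimes> b \<in> homog A (i + j)"
    and prod_closed: "\<lbrakk>a \<in> carrier A; b \<in> carrier A\<rbrakk> \<Longrightarrow> a \<otimes> b \<in> carrier A"
    and prod_l_distr: "\<lbrakk>a \<in> carrier A; b \<in> carrier A; c \<in> carrier A\<rbrakk>
      \<Longrightarrow> (a \<oplus> b) \<otimes> c = a \<otimes> c \<oplus> b \<otimes> c"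
    and prod_r_distr: "\<lbrakk>a \<in> carrier A; b \<in> carrier A; c \<in> carrier A\<rbrakk>
      \<Longrightarrow> c \<otimes> (a \<oplus> b) = c \<otimes> a \<oplus> c \<otimes> b"
    and prod_smult_l: "\<lbrakk>a \<in> carrier A; b \<in> carrier A\<rbrakk> \<Longrightarrow> (r \<odot> a) \<otimes> b = r \<odot> (a \<otimes> b)"
    and prod_smult_r: "\<lbrakk>a \<in> carrier A; b \<in> carrier A\<rbrakk> \<Longrightarrow> a \<otimes> (r \<odot> b) = r \<odot> (a \<otimes> b)"

text \<open>\<open>(-1)\<^sup>p\<close> for a parity \<open>p\<close>.\<close>

definition sgn2 :: "bit \<Rightarrow> 'k::field_char_0" where
  "sgn2 p = (if p = 0 then 1 else -1)"

locale zinbiel = superalgebra +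
  assumes zinbiel_identity: "\<lbrakk>a \<in> homog A i; b \<in> homog A j; c \<in> homog A k\<rbrakk>
    \<Longrightarrow> a \<otimes> (b \<otimes> c) = (a \<otimes> b) \<otimes> c \<oplus> sgn2 (i * j) \<odot> ((b \<otimes> a) \<otimes> c)"

text \<open>The Jacobian \<open>J\<^sub>s(x,y,z)\<close>, where \<open>j\<close> and \<open>k\<close> are the parities of \<open>y\<close> and \<open>z\<close>.\<close>

definition super_jacobian ::
  "('k::field_char_0, 'a) superalgebra \<Rightarrow> bit \<Rightarrow> bit \<Rightarrow> 'a \<Rightarrow> 'a \<Rightarrow> 'a \<Rightarrow> 'a" where
  "super_jacobian A j k x y z =
     ((x \<otimes>\<^bsub>A\<^esub> y) \<otimes>\<^bsub>A\<^esub> z \<ominus>\<^bsub>A\<^esub> x \<otimes>\<^bsub>A\<^esub> (y \<otimes>\<^bsub>A\<^esub> z)) \<ominus>\<^bsub>A\<^esub> sgn2 (j * k) \<odot>\<^bsub>A\<^esub> ((x \<otimes>\<^bsub>A\<^esub> z) \<otimes>\<^bsub>A\<^esub> y)"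

locale tortkara = superalgebra +
  assumes super_anticommutative: "\<lbrakk>a \<in> homog A i; b \<in> homog A j\<rbrakk>
    \<Longrightarrow> a \<otimes> b = \<ominus> (sgn2 (i * j) \<odot> (b \<otimes> a))"
  and tortkara_identity:
    "\<lbrakk>a \<in> homog A i; b \<in> homog A j; c \<in> homog A k; d \<in> homog A l\<rbrakk>
      \<Longrightarrow> (a \<otimes> b) \<otimes> (c \<otimes> d) \<ominus> sgn2 (l * (j + k)) \<odot> ((a \<otimes> d) \<otimes> (b \<otimes> c))
        = super_jacobian A j k a b c \<otimes> d
          \<oplus> sgn2 (i * j) \<odot> (b \<otimes> super_jacobian A k l a c d)"


section \<open>The supercommutator algebra\<close>

definition homog_part :: "('k::field_char_0, 'a) superalgebra \<Rightarrow> bit \<Rightarrow> 'a \<Rightarrow> 'a" where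
  "homog_part A i a =
     (THE c. c \<in> homog A i \<and> (\<exists>d \<in> homog A (i + 1). a = c \<oplus>\<^bsub>A\<^esub> d))"

text \<open>
  The formula for the bracket of homogeneous elements, extended bilinearly through the
  homogeneous parts; lemma \<open>supercommutator_homog\<close> below recovers the formula.
\<close>

definition supercommutator :: "('k::field_char_0, 'a) superalgebra \<Rightarrow> 'a \<Rightarrow> 'a \<Rightarrow> 'a" where
  "supercommutator A a b =
     (let br = (\<lambda>i j. homog_part A i a \<otimes>\<^bsub>A\<^esub> homog_part A j b
                  \<ominus>\<^bsub>A\<^esub> sgn2 (i * j) \<odot>\<^bsub>A\<^esub> (homog_part A j b \<otimes>\<^bsub>A\<^esub> homog_part A i a))
      in (br 0 0 \<oplus>\<^bsub>A\<^esub> br 0 1) \<oplus>\<^bsub>A\<^esub> (br 1 0 \<oplus>\<^bsub>A\<^esub> br 1 1))"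

definition commutator_algebra ::
  "('k::field_char_0, 'a) superalgebra \<Rightarrow> ('k, 'a) superalgebra" where
  "commutator_algebra A = A\<lparr>monoid.mult := supercommutator A\<rparr>"


section \<open>Subalgebras, ideals, quotients, isomorphisms\<close>

definition sub_superalgebra :: "('k::field_char_0, 'a) superalgebra \<Rightarrow> 'a set \<Rightarrow> bool" where
  "sub_superalgebra A H \<longleftrightarrow>
     submodule H scalars A \<and>
     H = (H \<inter> homog A 0) <+>\<^bsub>A\<^esub> (H \<inter> homog A 1) \<and>
     (\<forall>a\<in>H. \<forall>b\<in>H. a \<otimes>\<^bsub>A\<^esub> b \<in> H)"

definition restrict_superalgebra ::
  "('k::field_char_0, 'a) superalgebra \<Rightarrow> 'a set \<Rightarrow> ('k, 'a) superalgebra" where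
  "restrict_superalgebra A H = A\<lparr>carrier := H, homog := (\<lambda>i. homog A i \<inter> H)\<rparr>"

definition graded_ideal :: "('k::field_char_0, 'a) superalgebra \<Rightarrow> 'a set \<Rightarrow> bool" where
  "graded_ideal A I \<longleftrightarrow>
     submodule I scalars A \<and>
     I = (I \<inter> homog A 0) <+>\<^bsub>A\<^esub> (I \<inter> homog A 1) \<and>
     (\<forall>a\<in>carrier A. \<forall>x\<in>I. a \<otimes>\<^bsub>A\<^esub> x \<in> I \<and> x \<otimes>\<^bsub>A\<^esub> a \<in> I)"

text \<open>The quotient ring \<^const>\<open>FactRing\<close>, with scalar multiplication and grading added.\<close>

definition quotient_superalgebra ::
  "('k::field_char_0, 'a) superalgebra \<Rightarrow> 'a set \<Rightarrow> ('k, 'a set) superalgebra" where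
  "quotient_superalgebra A I =
     \<lparr>carrier = carrier (A Quot I), monoid.mult = monoid.mult (A Quot I), one = one (A Quot I),
      ring.zero = ring.zero (A Quot I), add = add (A Quot I),
      module.smult = (\<lambda>r C. \<Union>a\<in>C. I +>\<^bsub>A\<^esub> (r \<odot>\<^bsub>A\<^esub> a)),
      homog = (\<lambda>i. (\<lambda>a. I +>\<^bsub>A\<^esub> a) ` homog A i)\<rparr>"

definition superalgebra_hom ::
  "('k::field_char_0, 'a) superalgebra \<Rightarrow> ('k, 'b) superalgebra \<Rightarrow> ('a \<Rightarrow> 'b) set" where
  "superalgebra_hom A B =
     {f \<in> carrier A \<rightarrow> carrier B.
        (\<forall>a\<in>carrier A. \<forall>b\<in>carrier A. f (a \<oplus>\<^bsub>A\<^esub> b) = f a \<oplus>\<^bsub>B\<^esub> f b) \<and>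
        (\<forall>a\<in>carrier A. \<forall>b\<in>carrier A. f (a \<otimes>\<^bsub>A\<^esub> b) = f a \<otimes>\<^bsub>B\<^esub> f b) \<and>
        (\<forall>r. \<forall>a\<in>carrier A. f (r \<odot>\<^bsub>A\<^esub> a) = r \<odot>\<^bsub>B\<^esub> f a) \<and>
        (\<forall>i. f ` homog A i \<subseteq> homog B i)}"

definition superalgebra_iso ::
  "('k::field_char_0, 'a) superalgebra \<Rightarrow> ('k, 'b) superalgebra \<Rightarrow> ('a \<Rightarrow> 'b) set" where
  "superalgebra_iso A B = {f \<in> superalgebra_hom A B. bij_betw f (carrier A) (carrier B)}"


section \<open>Special and exceptional Tortkara superalgebras\<close>

text \<open>
  HOL cannot quantify over the type of the elements of the Zinbiel superalgebra, so it is
  taken to be the type of the elements of \<open>T\<close>. Nothing is lost: by a cardinality argument,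
  a \<open>T\<close> that embeds into some \<open>A\<^sup>(\<^sup>-\<^sup>)\<close> over an arbitrary type embeds into one over its own
  type, see \<open>special_if_embeds\<close> below.
\<close>

definition special :: "('k::field_char_0, 'a) superalgebra \<Rightarrow> bool" where
  "special T \<longleftrightarrow>
     (\<exists>(A :: ('k, 'a) superalgebra) H f.
        zinbiel A \<and> sub_superalgebra (commutator_algebra A) H \<and>
        f \<in> superalgebra_iso T (restrict_superalgebra (commutator_algebra A) H))"

definition exceptional :: "('k::field_char_0, 'a) superalgebra \<Rightarrow> bool" where
  "exceptional T \<longleftrightarrow> tortkara T \<and> \<not> special T"


section \<open>Independence of \<^const>\<open>special\<close> of the element type\<close>

text \<open>
  If \<open>T\<close> is isomorphic to a nonzero subalgebra \<open>H\<close> of \<open>A\<^sup>(\<^sup>-\<^sup>)\<close>, then \<open>T\<close> has at least as many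
  elements as the ground field, hence infinitely many, and the subalgebra of \<open>A\<close> generated
  by \<open>H\<close> is no larger than \<open>T\<close>, so it can be transported to the type of \<open>T\<close>.
\<close>

lemma scalars_simps [simp]:
  "carrier (scalars :: 'k::field_char_0 ring) = UNIV"
  "monoid.mult (scalars :: 'k ring) = (*)" "monoid.one (scalars :: 'k ring) = 1"
  "ring.zero (scalars :: 'k ring) = 0" "add (scalars :: 'k ring) = (+)"
  by (simp_all add: ring_of_type_algebra_def fun_eq_iff)

lemma scalars_cring: "cring (scalars :: 'k::field_char_0 ring)"
  by (rule cring_from_type_algebra)

lemma bit_add_self: "(i::bit) + 1 + 1 = i"
  by (cases i) auto

lemma (in superalgebra) homog_carrier: "a \<in> homog A i \<Longrightarrow> a \<in> carrier A"
  using submoduleE(1)[OF homog_submodule] by blast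

lemma (in superalgebra) homog_decomp:
  assumes "a \<in> carrier A"
  shows "\<exists>!c. c \<in> homog A i \<and> (\<exists>d \<in> homog A (i + 1). a = c \<oplus> d)"
proof -
  obtain u v where uv: "u \<in> homog A 0" "v \<in> homog A 1" "a = u \<oplus> v"
    using assms homog_span unfolding set_add_def set_mult_def by auto
  have ex: "\<exists>c. c \<in> homog A i \<and> (\<exists>d \<in> homog A (i + 1). a = c \<oplus> d)"
  proof (cases "i = 0")
    case True then show ?thesis using uv(1,2) by (intro exI[of _ u] conjI bexI[of _ v] uv(3)) auto
  next
    case False then have 1: "i = 1" by simp
    have "a = v \<oplus> u" using uv(3) M.a_comm[OF homog_carrier[OF uv(1)] homog_carrier[OF uv(2)]] by simp
    then show ?thesis using uv(1,2) 1 by (intro exI[of _ v] conjI bexI[of _ u]) auto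
  qed
  have int: "homog A i \<inter> homog A (i+1) = {\<zero>}"
    using homog_Int by (cases i) auto
  have "c = c'" if c: "c \<in> homog A i" "c' \<in> homog A i" "d \<in> homog A (i + 1)"
    "d' \<in> homog A (i + 1)" "c \<oplus> d = c' \<oplus> d'" for c c' d d'
  proof -
    note cc = c(1-4)[THEN homog_carrier]
    have "c \<ominus> c' = d' \<ominus> d"
    proof -
      have "c = (c' \<oplus> d') \<ominus> d"
        unfolding c(5)[symmetric] using cc by (simp add: a_minus_def M.a_assoc M.r_neg)
      also have "\<dots> = c' \<oplus> (d' \<ominus> d)"
        using cc by (simp add: a_minus_def M.a_assoc)
      finally have "c \<ominus> c' = \<ominus> c' \<oplus> (c' \<oplus> (d' \<ominus> d))"
        using cc by (simp add: a_minus_def M.a_comm)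
      then show ?thesis using cc by (simp add: M.r_neg1)
    qed
    moreover have "c \<ominus> c' \<in> homog A i" "d' \<ominus> d \<in> homog A (i+1)"
      unfolding a_minus_def
      by (intro submoduleE(3,5)[OF homog_submodule] c)+
    ultimately have "c \<ominus> c' = \<zero>" using int by auto
    then show ?thesis using cc by (metis M.a_inv_closed M.minus_equality M.minus_minus a_minus_def)
  qed
  then show ?thesis using ex by blast
qed

lemma (in superalgebra) homog_part_eqI:
  assumes "c \<in> homog A i" "d \<in> homog A (i + 1)" "a = c \<oplus> d"
  shows "homog_part A i a = c"
proof -
  have "a \<in> carrier A" using assms homog_carrier by auto
  then show ?thesis unfolding homog_part_def
    using assms by (intro the1_equality homog_decomp) auto
qed

lemma (in superalgebra) homog_part:
  assumes "a \<in> carrier A"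
  shows "homog_part A i a \<in> homog A i" "a = homog_part A i a \<oplus> homog_part A (i + 1) a"
proof -
  obtain c d where cd: "c \<in> homog A i" "d \<in> homog A (i + 1)" "a = c \<oplus> d"
    using homog_decomp[OF assms] by blast
  have "a = d \<oplus> c" using cd M.a_comm homog_carrier by auto
  then have "homog_part A i a = c" "homog_part A (i+1) a = d"
    using cd homog_part_eqI[of c i d a] homog_part_eqI[of d "i+1" c a] by (auto simp: bit_add_self)
  then show "homog_part A i a \<in> homog A i" "a = homog_part A i a \<oplus> homog_part A (i + 1) a"
    using cd by auto
qed

lemma (in superalgebra) homog_part_closed: "a \<in> carrier A \<Longrightarrow> homog_part A i a \<in> carrier A"
  using homog_part(1) homog_carrier by blast

lemma (in superalgebra) zero_homog: "\<zero> \<in> homog A i"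
  using homog_Int by (cases i) auto

lemma (in superalgebra) homog_part_homog:
  assumes "a \<in> homog A i"
  shows "homog_part A j a = (if i = j then a else \<zero>)"
proof (cases "i = j")
  case True
  have "homog_part A i a = a"
    using assms homog_carrier by (intro homog_part_eqI[of a i "\<zero>"] zero_homog) auto
  then show ?thesis using True by simp
next
  case False
  then have "i = j + 1" by (cases i; cases j) auto
  then have "homog_part A j a = \<zero>"
    using assms homog_carrier by (intro homog_part_eqI[of "\<zero>" j a] zero_homog) auto
  then show ?thesis using False by simp
qed

lemma (in superalgebra) prod_zero:
  assumes "a \<in> carrier A" shows "a \<otimes> \<zero> = \<zero>" "\<zero> \<otimes> a = \<zero>"
  using prod_smult_r[of a "\<zero>" 0] prod_smult_l[of "\<zero>" a 0] assms prod_closed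
    smult_l_null by auto

lemma (in superalgebra) supercommutator_homog:
  assumes "a \<in> homog A i" "b \<in> homog A j"
  shows "supercommutator A a b = a \<otimes> b \<ominus> sgn2 (i * j) \<odot> (b \<otimes> a)"
proof -
  have z: "\<zero> \<ominus> \<zero> = \<zero>" by (simp add: a_minus_def)
  have c: "a \<in> carrier A" "b \<in> carrier A" using assms homog_carrier by auto
  then show ?thesis
    unfolding supercommutator_def Let_def homog_part_homog[OF assms(1)] homog_part_homog[OF assms(2)]
    by (cases i; cases j) (auto simp: prod_zero z prod_closed M.minus_closed)
qed


lemma superalgebra_homD:
  assumes "h \<in> superalgebra_hom A B"
  shows "a \<in> carrier A \<Longrightarrow> h a \<in> carrier B"
    "a \<in> carrier A \<Longrightarrow> b \<in> carrier A \<Longrightarrow> h (a \<oplus>\<^bsub>A\<^esub> b) = h a \<oplus>\<^bsub>B\<^esub> h b"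
    "a \<in> carrier A \<Longrightarrow> b \<in> carrier A \<Longrightarrow> h (a \<otimes>\<^bsub>A\<^esub> b) = h a \<otimes>\<^bsub>B\<^esub> h b"
    "a \<in> carrier A \<Longrightarrow> h (r \<odot>\<^bsub>A\<^esub> a) = r \<odot>\<^bsub>B\<^esub> h a"
    "a \<in> homog A i \<Longrightarrow> h a \<in> homog B i"
  using assms by (simp_all add: superalgebra_hom_def Pi_iff) blast

lemma (in superalgebra) minus_one: "a \<in> carrier A \<Longrightarrow> \<ominus> a = (-1) \<odot> a"
proof -
  assume a: "a \<in> carrier A"
  have "(-1) \<odot> a \<oplus> a = (-1) \<odot> a \<oplus> 1 \<odot> a"
    using a smult_one[of a] by simp
  also have "\<dots> = (-1 + 1) \<odot> a"
    using a smult_l_distr[of "-1" 1 a] by simp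
  also have "\<dots> = \<zero>" using smult_l_null[of a] a by simp
  finally show ?thesis using a by (intro M.minus_equality) auto
qed

lemma superalgebra_hom_minus:
  assumes "superalgebra A" "superalgebra B" "h \<in> superalgebra_hom A B"
    "a \<in> carrier A" "b \<in> carrier A"
  shows "h (a \<ominus>\<^bsub>A\<^esub> b) = h a \<ominus>\<^bsub>B\<^esub> h b"
proof -
  interpret A: superalgebra A by fact
  interpret B: superalgebra B by fact
  show ?thesis
    using assms(4,5) A.smult_closed[of "-1" b]
    by (simp add: a_minus_def A.minus_one B.minus_one superalgebra_homD[OF assms(3)])
qed

lemma superalgebra_hom_part:
  assumes "superalgebra A" "superalgebra B" "h \<in> superalgebra_hom A B" "a \<in> carrier A"
  shows "h (homog_part A i a) = homog_part B i (h a)"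
proof -
  interpret A: superalgebra A by fact
  interpret B: superalgebra B by fact
  note hp = A.homog_part[OF assms(4)]
  show ?thesis
  proof (rule B.homog_part_eqI[symmetric])
    show "h (homog_part A i a) \<in> homog B i" "h (homog_part A (i+1) a) \<in> homog B (i+1)"
      by (intro superalgebra_homD[OF assms(3)] hp)+
    show "h a = h (homog_part A i a) \<oplus>\<^bsub>B\<^esub> h (homog_part A (i+1) a)"
      by (subst hp(2)[of i], rule superalgebra_homD[OF assms(3)])
        (auto intro: A.homog_part_closed assms)
  qed
qed

lemma superalgebra_hom_commutator:
  assumes "superalgebra A" "superalgebra B" "h \<in> superalgebra_hom A B"
  shows "h \<in> superalgebra_hom (commutator_algebra A) (commutator_algebra B)"
proof -
  interpret A: superalgebra A by fact
  interpret B: superalgebra B by fact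
  note [simp] = superalgebra_homD[OF assms(3)] superalgebra_hom_minus[OF assms]
    superalgebra_hom_part[OF assms] A.homog_part_closed A.prod_closed A.M.minus_closed
  have "h (supercommutator A a b) = supercommutator B (h a) (h b)"
    if "a \<in> carrier A" "b \<in> carrier A" for a b
    using that unfolding supercommutator_def Let_def by simp
  then show ?thesis
    by (auto simp: superalgebra_hom_def commutator_algebra_def)
qed

lemma (in superalgebra) supercommutator_closed:
  "a \<in> carrier A \<Longrightarrow> b \<in> carrier A \<Longrightarrow> supercommutator A a b \<in> carrier A"
  unfolding supercommutator_def Let_def
  by (intro M.a_closed M.minus_closed smult_closed prod_closed homog_part_closed) auto

lemma zinbiel_transport:
  fixes A :: "('k::field_char_0, 'b) superalgebra" and g :: "'b \<Rightarrow> 'a"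
  assumes "zinbiel A" "sub_superalgebra A G" "inj_on g G"
  shows "\<exists>(B :: ('k, 'a) superalgebra) h. zinbiel B \<and> carrier B = g ` G \<and>
    h \<in> superalgebra_hom B A \<and> inj_on h (carrier B) \<and> h ` carrier B = G \<and>
    (\<forall>b \<in> carrier B. \<forall>i. h b \<in> homog A i \<longrightarrow> b \<in> homog B i)"
proof -
  interpret A: zinbiel A by fact
  define h where "h = inv_into G g"
  have hg: "h (g x) = x" if "x \<in> G" for x
    using that assms(3) by (simp add: h_def)
  have gh: "g (h u) = u" "h u \<in> G" if "u \<in> g ` G" for u
    using that hg by auto
  have sub: "submodule G scalars A" using assms(2) by (simp add: sub_superalgebra_def)
  note G = A.submoduleE[OF sub]
  have Gp: "x \<otimes>\<^bsub>A\<^esub> y \<in> G" if xy: "x \<in> G" "y \<in> G" for x y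
    using that assms(2) by (simp add: sub_superalgebra_def)
  have GA: "x \<in> G \<Longrightarrow> x \<in> carrier A" for x using G(1) by blast
  have G0: "\<zero>\<^bsub>A\<^esub> \<in> G"
    using G(2) G(4)[of 0] A.smult_l_null GA by fastforce
  define B :: "('k, 'a) superalgebra" where "B =
    \<lparr>carrier = g ` G, monoid.mult = (\<lambda>u v. g (h u \<otimes>\<^bsub>A\<^esub> h v)), one = undefined,
     ring.zero = g \<zero>\<^bsub>A\<^esub>, add = (\<lambda>u v. g (h u \<oplus>\<^bsub>A\<^esub> h v)),
     module.smult = (\<lambda>r u. g (r \<odot>\<^bsub>A\<^esub> h u)),
     homog = (\<lambda>i. {u \<in> g ` G. h u \<in> homog A i})\<rparr>"
  have Bs: "carrier B = g ` G" "\<zero>\<^bsub>B\<^esub> = g \<zero>\<^bsub>A\<^esub>"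
    "u \<otimes>\<^bsub>B\<^esub> v = g (h u \<otimes>\<^bsub>A\<^esub> h v)" "u \<oplus>\<^bsub>B\<^esub> v = g (h u \<oplus>\<^bsub>A\<^esub> h v)"
    "r \<odot>\<^bsub>B\<^esub> u = g (r \<odot>\<^bsub>A\<^esub> h u)" "homog B i = {u \<in> g ` G. h u \<in> homog A i}" for u v r i
    by (simp_all add: B_def)
  have Ginv: "\<ominus>\<^bsub>A\<^esub> x \<in> G" if "x \<in> G" for x
    using G(3) that by blast
  have Gadd: "x \<oplus>\<^bsub>A\<^esub> y \<in> G" if "x \<in> G" "y \<in> G" for x y
    using G(5) that by blast
  have Gsm: "r \<odot>\<^bsub>A\<^esub> x \<in> G" if "x \<in> G" for x r
    using G(4) that by simp
  note s = Bs hg Gp GA G0 Ginv Gadd Gsm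
  have ab: "abelian_group B"
  proof (rule abelian_groupI)
    fix x assume "x \<in> carrier B"
    then obtain a where a: "x = g a" "a \<in> G" by (auto simp: Bs)
    show "\<exists>y \<in> carrier B. y \<oplus>\<^bsub>B\<^esub> x = \<zero>\<^bsub>B\<^esub>"
      using a by (intro bexI[of _ "g (\<ominus>\<^bsub>A\<^esub> a)"]) (auto simp: s A.M.l_neg)
  qed (auto simp: s A.M.a_ac)
  have md: "module scalars B"
    by (rule moduleI[OF scalars_cring ab])
      (auto simp: s A.smult_assoc1[simplified] A.smult_l_distr[simplified]
        A.smult_r_distr[simplified] A.smult_one[simplified])
  interpret B: module scalars B by (rule md)
  have Binv: "\<ominus>\<^bsub>B\<^esub> g a = g (\<ominus>\<^bsub>A\<^esub> a)" if "a \<in> G" for a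
    using that by (intro B.M.minus_equality) (auto simp: s A.M.l_neg)
  have Hm: "submodule (homog B i) scalars B" for i
    by (rule B.submoduleI)
      (auto simp: s Binv A.submoduleE[OF A.homog_submodule[of i]] A.zero_homog)
  have Gpart: "homog_part A i a \<in> G" if "a \<in> G" for i a
  proof -
    have "a \<in> (G \<inter> homog A 0) <+>\<^bsub>A\<^esub> (G \<inter> homog A 1)"
      using assms(2) that by (simp add: sub_superalgebra_def)
    then obtain c d where cd: "c \<in> G" "c \<in> homog A 0" "d \<in> G" "d \<in> homog A 1" "a = c \<oplus>\<^bsub>A\<^esub> d"
      unfolding set_add_def set_mult_def by auto
    have "a = d \<oplus>\<^bsub>A\<^esub> c" using cd(5) A.M.a_comm[OF GA[OF cd(1)] GA[OF cd(3)]] by simp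
    then have "homog_part A 0 a = c" "homog_part A 1 a = d"
      using A.homog_part_eqI[of c 0 d a] A.homog_part_eqI[of d 1 c a] cd by auto
    then show ?thesis using cd by (cases "i = 0") auto
  qed
  have "superalgebra B"
  proof (intro superalgebra.intro superalgebra_axioms.intro md Hm)
    show "carrier B = homog B 0 <+>\<^bsub>B\<^esub> homog B 1"
    proof (intro equalityI subsetI)
      fix u assume "u \<in> carrier B"
      then obtain a where a: "a \<in> G" "u = g a" by (auto simp: Bs)
      have "u = g (homog_part A 0 a) \<oplus>\<^bsub>B\<^esub> g (homog_part A 1 a)"
        using a A.homog_part(2)[OF GA[OF a(1)], of 0] Gpart by (simp add: s)
      moreover have "g (homog_part A i a) \<in> homog B i" for i
        using a Gpart A.homog_part(1)[OF GA] by (simp add: s)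
      ultimately show "u \<in> homog B 0 <+>\<^bsub>B\<^esub> homog B 1"
        unfolding set_add_def set_mult_def by auto
    qed (auto simp: set_add_def set_mult_def s)
    show "homog B 0 \<inter> homog B 1 = {\<zero>\<^bsub>B\<^esub>}"
    proof (intro equalityI subsetI)
      fix u assume "u \<in> homog B 0 \<inter> homog B 1"
      then have "u \<in> g ` G" "h u \<in> homog A 0 \<inter> homog A 1" by (auto simp: Bs)
      then show "u \<in> {\<zero>\<^bsub>B\<^esub>}" using gh(1)[of u] by (simp add: A.homog_Int Bs)
    qed (use A.zero_homog in \<open>auto simp: s\<close>)
    show "u \<otimes>\<^bsub>B\<^esub> v \<in> homog B (i + j)" if "u \<in> homog B i" "v \<in> homog B j" for u v i j
    proof -
      have "h u \<in> G" "h v \<in> G" using that gh(2) by (auto simp: Bs)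
      moreover have "h u \<otimes>\<^bsub>A\<^esub> h v \<in> homog A (i + j)"
        using that by (intro A.prod_homog) (auto simp: Bs)
      ultimately show ?thesis by (simp add: s)
    qed
  qed (auto simp: s A.prod_l_distr A.prod_r_distr A.prod_smult_l A.prod_smult_r)
  then have "zinbiel B"
    by (intro zinbiel.intro zinbiel_axioms.intro)
      (auto simp: s A.zinbiel_identity)
  moreover have "h \<in> superalgebra_hom B A"
    by (auto simp: superalgebra_hom_def s)
  moreover have "inj_on h (carrier B)" by (auto simp: s inj_on_def)
  moreover have "h ` carrier B = G" by (auto simp: s image_image)
  ultimately show ?thesis by (intro exI[of _ B] exI[of _ h]) (auto simp: s)
qed

lemma special_transport:
  fixes A :: "('k::field_char_0, 'b) superalgebra" and T :: "('k, 'a) superalgebra"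
    and g :: "'b \<Rightarrow> 'a"
  assumes "zinbiel A" "sub_superalgebra (commutator_algebra A) H"
    "f \<in> superalgebra_iso T (restrict_superalgebra (commutator_algebra A) H)"
    "sub_superalgebra A G" "H \<subseteq> G" "inj_on g G"
  shows "special T"
proof -
  interpret A: zinbiel A by fact
  obtain B :: "('k, 'a) superalgebra" and h where B: "zinbiel B" "carrier B = g ` G"
    "h \<in> superalgebra_hom B A" "inj_on h (carrier B)" "h ` carrier B = G"
    "\<And>b i. b \<in> carrier B \<Longrightarrow> h b \<in> homog A i \<Longrightarrow> b \<in> homog B i"
    using zinbiel_transport[OF assms(1,4,6)] by blast
  interpret B: zinbiel B by fact
  let ?CA = "commutator_algebra A" and ?CB = "commutator_algebra B"
  have hC: "h \<in> superalgebra_hom ?CB ?CA"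
    by (rule superalgebra_hom_commutator) (unfold_locales, fact B)
  define k where "k = inv_into (carrier B) h"
  define H' where "H' = k ` H"
  have hk: "h (k x) = x" "k x \<in> carrier B" if "x \<in> H" for x
    using that B(5) assms(5) by (auto simp: k_def f_inv_into_f inv_into_into)
  have keq: "k x = b" if "b \<in> carrier B" "h b = x" for b x
    using that B(4) by (auto simp: k_def)
  have kh: "b \<in> H'" if "b \<in> carrier B" "h b \<in> H" for b
    using that keq unfolding H'_def by (metis imageI)
  have H'B: "H' \<subseteq> carrier B" and hH': "h b \<in> H" if "b \<in> H'" for b
    using hk that by (auto simp: H'_def)
  have subH: "submodule H scalars A"
    using assms(2) unfolding sub_superalgebra_def submodule_def submodule_axioms_def subgroup_def
    by (simp add: commutator_algebra_def a_inv_def m_inv_def)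
  note subHE = A.submoduleE[OF subH]
  have Hhom: "H = (H \<inter> homog A 0) <+>\<^bsub>A\<^esub> (H \<inter> homog A 1)"
    using assms(2) unfolding sub_superalgebra_def set_add_def
    by (simp add: commutator_algebra_def)
  have HA: "x \<in> carrier A" if "x \<in> H" for x using subHE(1) that by blast
  have Hop: "x \<oplus>\<^bsub>A\<^esub> y \<in> H" "supercommutator A x y \<in> H"
    if "x \<in> H" "y \<in> H" for x y
    using that subHE assms(2) by (auto simp: sub_superalgebra_def commutator_algebra_def)
  have Hsm: "r \<odot>\<^bsub>A\<^esub> x \<in> H" if "x \<in> H" for x r
    using that subHE by auto
  note hB = superalgebra_homD[OF B(3)]
  have hcom: "h (supercommutator B a b) = supercommutator A (h a) (h b)"
    if "a \<in> carrier B" "b \<in> carrier B" for a b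
    using superalgebra_homD(3)[OF hC, of a b] that by (simp add: commutator_algebra_def)
  have H'c: "a \<in> carrier B" if "a \<in> H'" for a using H'B that by blast
  have H'add: "a \<oplus>\<^bsub>B\<^esub> b \<in> H'" if "a \<in> H'" "b \<in> H'" for a b
    using that by (intro kh) (auto simp: H'c hB hH' Hop Hsm)
  have H'sm: "r \<odot>\<^bsub>B\<^esub> a \<in> H'" if "a \<in> H'" for a r
    using that by (intro kh) (auto simp: H'c hB hH' Hop Hsm)
  have H'com: "supercommutator B a b \<in> H'" if "a \<in> H'" "b \<in> H'" for a b
    using that by (intro kh) (auto simp: H'c hcom hH' Hop B.supercommutator_closed)
  have "H' \<noteq> {}" using subHE(2) by (auto simp: H'_def)
  then have "submodule H' scalars B"
    using H'B H'add H'sm B.minus_one H'c by (intro B.submoduleI) (auto, metis B.smult_l_null scalars_simps(4))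
  then have sm: "submodule H' scalars ?CB"
    unfolding submodule_def submodule_axioms_def subgroup_def
    by (simp add: commutator_algebra_def a_inv_def m_inv_def)
  have "H' = (H' \<inter> homog B 0) <+>\<^bsub>B\<^esub> (H' \<inter> homog B 1)"
  proof (intro equalityI subsetI)
    fix b assume b: "b \<in> H'"
    have "h b \<in> (H \<inter> homog A 0) <+>\<^bsub>A\<^esub> (H \<inter> homog A 1)"
      using hH'[OF b] Hhom by simp
    then obtain c d where cd: "c \<in> H" "c \<in> homog A 0" "d \<in> H" "d \<in> homog A 1" "h b = c \<oplus>\<^bsub>A\<^esub> d"
      unfolding set_add_def set_mult_def by auto
    have "b = k c \<oplus>\<^bsub>B\<^esub> k d"
    proof -
      have "h b = h (k c \<oplus>\<^bsub>B\<^esub> k d)" using cd by (simp add: hB hk)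
      then show ?thesis using B(4) H'c[OF b] hk cd by (auto dest!: inj_onD)
    qed
    moreover have "k c \<in> H' \<inter> homog B 0" "k d \<in> H' \<inter> homog B 1"
      using cd hk B(6) by (auto simp: H'_def)
    ultimately show "b \<in> (H' \<inter> homog B 0) <+>\<^bsub>B\<^esub> (H' \<inter> homog B 1)"
      unfolding set_add_def set_mult_def by auto
  qed (auto simp: set_add_def set_mult_def H'add)
  then have sub: "sub_superalgebra ?CB H'"
    using sm H'com unfolding sub_superalgebra_def set_add_def
    by (simp add: commutator_algebra_def)
  have f: "f \<in> superalgebra_hom T (restrict_superalgebra ?CA H)" "bij_betw f (carrier T) H"
    using assms(3) by (auto simp: superalgebra_iso_def restrict_superalgebra_def)
  note fD = superalgebra_homD[OF f(1), unfolded restrict_superalgebra_def commutator_algebra_def, simplified]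
  have kadd: "k (x \<oplus>\<^bsub>A\<^esub> y) = k x \<oplus>\<^bsub>B\<^esub> k y"
    and kcom: "k (supercommutator A x y) = supercommutator B (k x) (k y)"
    if "x \<in> H" "y \<in> H" for x y
    using that by (intro keq; simp add: hk hB hcom B.supercommutator_closed)+
  have ksm: "k (r \<odot>\<^bsub>A\<^esub> x) = r \<odot>\<^bsub>B\<^esub> k x" if "x \<in> H" for x r
    using that by (intro keq; simp add: hk hB)+
  have khom: "k x \<in> homog B i" if "x \<in> H" "x \<in> homog A i" for x i
    using that hk B(6) by auto
  have "k \<circ> f \<in> superalgebra_hom T (restrict_superalgebra ?CB H')"
    using fD by (auto simp: superalgebra_hom_def restrict_superalgebra_def commutator_algebra_def
      H'_def kadd ksm kcom khom)
  moreover have "bij_betw (k \<circ> f) (carrier T) H'"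
  proof (rule bij_betw_trans[OF f(2)])
    show "bij_betw k H H'"
      unfolding H'_def using hk(1) by (intro inj_on_imp_bij_betw inj_on_inverseI)
  qed
  ultimately have "k \<circ> f \<in> superalgebra_iso T (restrict_superalgebra ?CB H')"
    by (simp add: superalgebra_iso_def restrict_superalgebra_def)
  then show ?thesis unfolding special_def using B(1) sub by blast
qed

lemma small_subalgebra:
  includes cardinal_syntax
  fixes A :: "('k::field_char_0, 'b) superalgebra"
  assumes "superalgebra A" "H \<subseteq> carrier A" "|H| \<le>o |UNIV :: 'a set|"
    and inf: "infinite (UNIV :: 'a set)" and K: "|UNIV :: 'k set| \<le>o |UNIV :: 'a set|"
  shows "\<exists>G. sub_superalgebra A G \<and> H \<subseteq> G \<and> |G| \<le>o |UNIV :: 'a set|"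
proof -
  interpret A: superalgebra A by fact
  define step where "step S =
    ((((S \<union> (\<lambda>(x,y). x \<oplus>\<^bsub>A\<^esub> y) ` (S \<times> S)) \<union> (\<lambda>(x,y). x \<otimes>\<^bsub>A\<^esub> y) ` (S \<times> S)) \<union>
     (\<lambda>(r,x). r \<odot>\<^bsub>A\<^esub> x) ` ((UNIV :: 'k set) \<times> S)) \<union>
     homog_part A 0 ` S) \<union> homog_part A 1 ` S" for S
  define C where "C n = (step ^^ n) (insert \<zero>\<^bsub>A\<^esub> H)" for n
  define G where "G = (\<Union>n. C n)"
  have CS: "C (Suc n) = step (C n)" for n by (simp add: C_def)
  have Cc: "C n \<subseteq> carrier A" for n
  proof (induction n)
    case 0 then show ?case using assms(2) by (auto simp: C_def)
  next
    case (Suc n)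
    then show ?case unfolding CS step_def
      by (auto simp: subset_iff A.prod_closed A.homog_part_closed)
  qed
  have Csub: "C n \<subseteq> C (Suc n)" for n unfolding CS step_def by auto
  then have Cmono: "C m \<subseteq> C n" if "m \<le> n" for m n using lift_Suc_mono_le[of C] that by blast
  have two: "\<exists>n. x \<in> C n \<and> y \<in> C n" if xy: "x \<in> G" "y \<in> G" for x y
  proof -
    obtain m n where "x \<in> C m" "y \<in> C n" using xy unfolding G_def by blast
    then show ?thesis using Cmono[of m "max m n"] Cmono[of n "max m n"] by auto
  qed
  have Un: "|P \<union> Q| \<le>o |UNIV :: 'a set|"
    if "|P| \<le>o |UNIV :: 'a set|" "|Q| \<le>o |UNIV :: 'a set|" for P Q :: "'x set"
    using inf by (intro card_of_Un_ordLeq_infinite_Field that card_of_Card_order) (simp add: Field_card_of)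
  have Tm: "|P \<times> Q| \<le>o |UNIV :: 'a set|"
    if "|P| \<le>o |UNIV :: 'a set|" "|Q| \<le>o |UNIV :: 'a set|" for P :: "'x set" and Q :: "'y set"
    using inf by (intro card_of_Times_ordLeq_infinite_Field that card_of_Card_order) (simp add: Field_card_of)
  have card: "|C n| \<le>o |UNIV :: 'a set|" for n
  proof (induction n)
    case 0
    have "|{\<zero>\<^bsub>A\<^esub>}| \<le>o |UNIV :: 'a set|"
      by (rule card_of_ordLeqI[of "\<lambda>_. undefined"]) auto
    then have "|{\<zero>\<^bsub>A\<^esub>} \<union> H| \<le>o |UNIV :: 'a set|"
      using Un assms(3) by blast
    then show ?case by (simp add: C_def)
  next
    case (Suc n)
    have im: "|f ` S| \<le>o |UNIV :: 'a set|" if "|S| \<le>o |UNIV :: 'a set|" for S :: "'x set" and f :: "'x \<Rightarrow> 'b"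
      using card_of_image that by (rule ordLeq_transitive)
    show ?case unfolding CS step_def
      by (intro Un im Tm Suc K)
  qed
  have "|UNIV :: nat set| \<le>o |UNIV :: 'a set|"
    using inf by (simp add: infinite_iff_card_of_nat)
  then have Gcard: "|G| \<le>o |UNIV :: 'a set|"
    unfolding G_def using card by (intro card_of_UNION_ordLeq_infinite[OF inf]) auto
  have Gc: "G \<subseteq> carrier A" using Cc by (auto simp: G_def)
  have GH: "insert \<zero>\<^bsub>A\<^esub> H \<subseteq> G" unfolding G_def by (rule UN_upper[of 0, THEN subset_trans[rotated]]) (auto simp: C_def)
  have Gop: "x \<oplus>\<^bsub>A\<^esub> y \<in> G" "x \<otimes>\<^bsub>A\<^esub> y \<in> G" if xy: "x \<in> G" "y \<in> G" for x y
  proof -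
    obtain n where n: "x \<in> C n" "y \<in> C n" using two[OF xy] by blast
    then have "x \<oplus>\<^bsub>A\<^esub> y \<in> C (Suc n)" "x \<otimes>\<^bsub>A\<^esub> y \<in> C (Suc n)"
      unfolding CS step_def by force+
    then show "x \<oplus>\<^bsub>A\<^esub> y \<in> G" "x \<otimes>\<^bsub>A\<^esub> y \<in> G" by (auto simp: G_def)
  qed
  have Gop1: "r \<odot>\<^bsub>A\<^esub> x \<in> G" "homog_part A i x \<in> G" if x: "x \<in> G" for x r i
  proof -
    obtain n where n: "x \<in> C n" using x unfolding G_def by blast
    have "i \<in> {0,1}" by (cases i) auto
    then have "r \<odot>\<^bsub>A\<^esub> x \<in> C (Suc n)" "homog_part A i x \<in> C (Suc n)"
      using n unfolding CS step_def by force+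
    then show "r \<odot>\<^bsub>A\<^esub> x \<in> G" "homog_part A i x \<in> G" by (auto simp: G_def)
  qed
  have "submodule G scalars A"
    using Gc GH Gop Gop1 A.minus_one by (intro A.submoduleI) (auto simp: subset_iff)
  moreover have "G = (G \<inter> homog A 0) <+>\<^bsub>A\<^esub> (G \<inter> homog A 1)"
  proof (intro equalityI subsetI)
    fix x assume x: "x \<in> G"
    then have "x = homog_part A 0 x \<oplus>\<^bsub>A\<^esub> homog_part A 1 x"
      using A.homog_part(2)[of x 0] Gc by auto
    moreover have "homog_part A i x \<in> G \<inter> homog A i" for i
      using x Gc Gop1 A.homog_part(1) by blast
    ultimately show "x \<in> (G \<inter> homog A 0) <+>\<^bsub>A\<^esub> (G \<inter> homog A 1)"
      unfolding set_add_def set_mult_def by auto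
  qed (auto simp: set_add_def set_mult_def Gop)
  ultimately have "sub_superalgebra A G" using Gop by (auto simp: sub_superalgebra_def)
  then show ?thesis using GH Gcard by blast
qed

theorem special_if_embeds:
  fixes A :: "('k::field_char_0, 'b) superalgebra" and T :: "('k, 'a) superalgebra"
  assumes "zinbiel A" "sub_superalgebra (commutator_algebra A) H"
    "f \<in> superalgebra_iso T (restrict_superalgebra (commutator_algebra A) H)"
  shows "special T"
proof -
  include cardinal_syntax
  interpret A: zinbiel A by fact
  have f: "bij_betw f (carrier T) H"
    using assms(3) by (auto simp: superalgebra_iso_def restrict_superalgebra_def)
  have subH: "submodule H scalars A"
    using assms(2) unfolding sub_superalgebra_def submodule_def submodule_axioms_def subgroup_def
    by (simp add: commutator_algebra_def a_inv_def m_inv_def)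
  note H = A.submoduleE[OF subH]
  have HT: "|H| \<le>o |UNIV :: 'a set|"
    using f by (intro card_of_ordLeqI[of "inv_into (carrier T) f"])
      (auto simp: bij_betw_def inj_on_inv_into)
  show ?thesis
  proof (cases "H \<subseteq> {\<zero>\<^bsub>A\<^esub>}")
    case True
    have "submodule {\<zero>\<^bsub>A\<^esub>} scalars A"
      by (rule A.submoduleI) (auto simp: A.smult_r_null)
    moreover have "{\<zero>\<^bsub>A\<^esub>} = ({\<zero>\<^bsub>A\<^esub>} \<inter> homog A 0) <+>\<^bsub>A\<^esub> ({\<zero>\<^bsub>A\<^esub>} \<inter> homog A 1)"
      using A.zero_homog by (auto simp: set_add_def set_mult_def)
    ultimately have "sub_superalgebra A {\<zero>\<^bsub>A\<^esub>}"
      by (auto simp: sub_superalgebra_def A.prod_zero)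
    then show ?thesis
      using special_transport[OF assms _ True, of "\<lambda>_. undefined"] by simp
  next
    case False
    then obtain t where t: "t \<in> H" "t \<noteq> \<zero>\<^bsub>A\<^esub>" "t \<in> carrier A" using H(1) by blast
    have "r = s" if "r \<odot>\<^bsub>A\<^esub> t = s \<odot>\<^bsub>A\<^esub> t" for r s
    proof (rule ccontr)
      assume "r \<noteq> s"
      have "(r - s) \<odot>\<^bsub>A\<^esub> t = r \<odot>\<^bsub>A\<^esub> t \<oplus>\<^bsub>A\<^esub> (- s) \<odot>\<^bsub>A\<^esub> t"
        using A.smult_l_distr[of r "-s" t] t by simp
      also have "\<dots> = (s - s) \<odot>\<^bsub>A\<^esub> t"
        using A.smult_l_distr[of s "-s" t] t that by simp
      also have "\<dots> = \<zero>\<^bsub>A\<^esub>" using A.smult_l_null t by simp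
      finally have z: "(r - s) \<odot>\<^bsub>A\<^esub> t = \<zero>\<^bsub>A\<^esub>" .
      have "t = (inverse (r - s) * (r - s)) \<odot>\<^bsub>A\<^esub> t"
        using \<open>r \<noteq> s\<close> A.smult_one[of t] t by simp
      also have "\<dots> = inverse (r - s) \<odot>\<^bsub>A\<^esub> ((r - s) \<odot>\<^bsub>A\<^esub> t)"
        using A.smult_assoc1[of "inverse (r - s)" "r - s" t] t by simp
      finally show False using t z A.smult_r_null by simp
    qed
    then have "|UNIV :: 'k set| \<le>o |H|"
      using H(4) t by (intro card_of_ordLeqI[of "\<lambda>r. r \<odot>\<^bsub>A\<^esub> t"]) (auto simp: inj_on_def)
    then have K: "|UNIV :: 'k set| \<le>o |UNIV :: 'a set|"
      using HT by (rule ordLeq_transitive)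
    have inf: "infinite (UNIV :: 'a set)"
      using card_of_ordLeq_infinite[OF K] infinite_UNIV_char_0 by blast
    obtain G where G: "sub_superalgebra A G" "H \<subseteq> G" "|G| \<le>o |UNIV :: 'a set|"
      using small_subalgebra[OF A.superalgebra_axioms H(1) HT inf K] by blast
    obtain g :: "'b \<Rightarrow> 'a" where "inj_on g G"
      using G(3) unfolding card_of_ordLeq[symmetric] by blast
    then show ?thesis using special_transport[OF assms G(1,2)] by blast
  qed
qed


section \<open>Free Zinbiel and free special Tortkara superalgebras\<close>

text \<open>
  The free superalgebra on generators of type \<open>'x\<close> with parities \<open>par\<close> has the
  nonassociative monomials as a basis; the free Zinbiel superalgebra is its quotient by the
  ideal generated by all instances of the Zinbiel identity.
\<close>

datatype 'x monomial = Gen 'x | Prod "'x monomial" "'x monomial"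

primrec monomial_parity :: "('x \<Rightarrow> bit) \<Rightarrow> 'x monomial \<Rightarrow> bit" where
  "monomial_parity par (Gen x) = par x"
| "monomial_parity par (Prod s t) = monomial_parity par s + monomial_parity par t"

definition free_superalgebra ::
  "('x \<Rightarrow> bit) \<Rightarrow> ('k::field_char_0, 'x monomial \<Rightarrow>\<^sub>0 'k) superalgebra" where
  "free_superalgebra par =
     \<lparr>carrier = UNIV,
      monoid.mult = (\<lambda>p q. \<Sum>s\<in>Poly_Mapping.keys p. \<Sum>t\<in>Poly_Mapping.keys q.
        Poly_Mapping.single (Prod s t) (Poly_Mapping.lookup p s * Poly_Mapping.lookup q t)),
      one = undefined, ring.zero = 0, add = (+),
      module.smult = (\<lambda>r. Poly_Mapping.map ((*) r)),
      homog = (\<lambda>i. {p. \<forall>s\<in>Poly_Mapping.keys p. monomial_parity par s = i})\<rparr>"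

definition zinbiel_relations :: "('k::field_char_0, 'a) superalgebra \<Rightarrow> 'a set" where
  "zinbiel_relations A =
     {a \<otimes>\<^bsub>A\<^esub> (b \<otimes>\<^bsub>A\<^esub> c) \<ominus>\<^bsub>A\<^esub> ((a \<otimes>\<^bsub>A\<^esub> b) \<otimes>\<^bsub>A\<^esub> c \<oplus>\<^bsub>A\<^esub> sgn2 (i * j) \<odot>\<^bsub>A\<^esub> ((b \<otimes>\<^bsub>A\<^esub> a) \<otimes>\<^bsub>A\<^esub> c))
      | a b c i j k. a \<in> homog A i \<and> b \<in> homog A j \<and> c \<in> homog A k}"

definition zinbiel_ideal :: "('x \<Rightarrow> bit) \<Rightarrow> ('x monomial \<Rightarrow>\<^sub>0 'k::field_char_0) set" where
  "zinbiel_ideal par =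
     graded_ideal (free_superalgebra par) hull zinbiel_relations (free_superalgebra par)"

definition free_zinbiel ::
  "('x \<Rightarrow> bit) \<Rightarrow> ('k::field_char_0, ('x monomial \<Rightarrow>\<^sub>0 'k) set) superalgebra" where
  "free_zinbiel par = quotient_superalgebra (free_superalgebra par) (zinbiel_ideal par)"

definition zinbiel_gen ::
  "('x \<Rightarrow> bit) \<Rightarrow> 'x \<Rightarrow> ('x monomial \<Rightarrow>\<^sub>0 'k::field_char_0) set" where
  "zinbiel_gen par x =
     zinbiel_ideal par +>\<^bsub>free_superalgebra par\<^esub> Poly_Mapping.single (Gen x) 1"

definition free_special_tortkara ::
  "('x \<Rightarrow> bit) \<Rightarrow> ('k::field_char_0, ('x monomial \<Rightarrow>\<^sub>0 'k) set) superalgebra" where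
  "free_special_tortkara par =
     (let C = commutator_algebra (free_zinbiel par)
      in restrict_superalgebra C (sub_superalgebra C hull range (zinbiel_gen par)))"

datatype xy = GX | GY

primrec xy_parity :: "xy \<Rightarrow> bit" where
  "xy_parity GX = 1"
| "xy_parity GY = 0"

end

theory Submission
  imports Defs
begin

text \<open>
  With left-normed words for iterated products, \<open>[x,[x,y]] = -2 yxx\<close> in a Zinbiel superalgebra with
  \<open>x\<close> odd and \<open>y\<close> even, and \<open>[[x,x],x] = 2 xxx\<close>. The element
  \<open>[[[x,x],y],x] = 2 (xxyx - yxxx - xyxx - xxxy)\<close> lies in the Zinbiel ideal generated by these two, so
  it vanishes in every special superalgebra in which \<open>[x,[x,y]] = [[x,x],x] = 0\<close>. It does not lie in
  the ideal of \<open>ST(x,y)\<close> generated by them: there is a Zinbiel superalgebra \<open>M\<close> of dimension eight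
  in which \<open>[[x,x],x] = 0\<close>, \<open>yxx\<close> spans an ideal of \<open>M\<^sup>(\<^sup>-\<^sup>)\<close>, and \<open>[[[x,x],y],x]\<close>
  is not in this ideal. The preimage of the ideal in \<open>ST(x,y)\<close> is the kernel sought.
\<close>

section \<open>Superalgebra constructions\<close>

text \<open>The mechanism is the behaviour of the even element yxx of M. In every Zinbiel
  superalgebra (yxx)x = yxxx and x(yxx) = xyxx, so identifying xyxx with yxxx makes both products
  equal to \<open>Vtop\<close>. The bracket of yxx with x is their difference and vanishes, while
  the Zinbiel expression of [[[x,x],y],x] contains their sum, which leaves -8 \<open>Vtop\<close>.
  Hence the line through yxx is an ideal for the bracket but not for the product. The relation on
  xxy comes from xxx = 0: it forces 0 = y(xxx) = xxyx + xyxx + yxxx, and imposing this already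
  without the last x saves a basis element. Being exceptional includes being Tortkara, so the
  Tortkara identity has to be established for the bracket of an arbitrary Zinbiel superalgebra. This
  identity and the obstruction to being special are both settled by one calculus, the expansion of
  products into left-normed words. The free Zinbiel superalgebra itself is reached only through its
  homomorphism to M, never through a basis.\<close>

lemma superalgebraI:
  fixes A :: "('k::field_char_0, 'a) superalgebra" (structure)
  assumes ab: "abelian_group A"
    and smult: "\<And>r a. a \<in> carrier A \<Longrightarrow> r \<odot> a \<in> carrier A"
      "\<And>r s a. a \<in> carrier A \<Longrightarrow> (r + s) \<odot> a = r \<odot> a \<oplus> s \<odot> a"
      "\<And>r a b. a \<in> carrier A \<Longrightarrow> b \<in> carrier A \<Longrightarrow> r \<odot> (a \<oplus> b) = r \<odot> a \<oplus> r \<odot> b"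
      "\<And>r s a. a \<in> carrier A \<Longrightarrow> (r * s) \<odot> a = r \<odot> (s \<odot> a)"
      "\<And>a. a \<in> carrier A \<Longrightarrow> 1 \<odot> a = a"
    and homog: "\<And>i a. a \<in> homog A i \<Longrightarrow> a \<in> carrier A"
      "\<And>i. \<zero> \<in> homog A i"
      "\<And>i a b. a \<in> homog A i \<Longrightarrow> b \<in> homog A i \<Longrightarrow> a \<oplus> b \<in> homog A i"
      "\<And>i r a. a \<in> homog A i \<Longrightarrow> r \<odot> a \<in> homog A i"
      "\<And>a. a \<in> carrier A \<Longrightarrow> \<exists>b\<in>homog A 0. \<exists>c\<in>homog A 1. a = b \<oplus> c"
      "\<And>a. a \<in> homog A 0 \<Longrightarrow> a \<in> homog A 1 \<Longrightarrow> a = \<zero>"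
    and prod: "\<And>i j a b. a \<in> homog A i \<Longrightarrow> b \<in> homog A j \<Longrightarrow> a \<otimes> b \<in> homog A (i + j)"
      "\<And>a b. a \<in> carrier A \<Longrightarrow> b \<in> carrier A \<Longrightarrow> a \<otimes> b \<in> carrier A"
      "\<And>a b c. a \<in> carrier A \<Longrightarrow> b \<in> carrier A \<Longrightarrow> c \<in> carrier A \<Longrightarrow> (a \<oplus> b) \<otimes> c = a \<otimes> c \<oplus> b \<otimes> c"
      "\<And>a b c. a \<in> carrier A \<Longrightarrow> b \<in> carrier A \<Longrightarrow> c \<in> carrier A \<Longrightarrow> c \<otimes> (a \<oplus> b) = c \<otimes> a \<oplus> c \<otimes> b"
      "\<And>r a b. a \<in> carrier A \<Longrightarrow> b \<in> carrier A \<Longrightarrow> (r \<odot> a) \<otimes> b = r \<odot> (a \<otimes> b)"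
      "\<And>r a b. a \<in> carrier A \<Longrightarrow> b \<in> carrier A \<Longrightarrow> a \<otimes> (r \<odot> b) = r \<odot> (a \<otimes> b)"
  shows "superalgebra A"
proof -
  interpret module scalars A
    by (rule moduleI[OF scalars_cring ab]) (simp_all add: smult)
  have minus: "\<ominus> a = (-1) \<odot> a" if a: "a \<in> carrier A" for a
  proof (rule M.minus_equality)
    have "(-1) \<odot> a \<oplus> a = (-1 + 1) \<odot> a"
      using a smult(2)[of a "-1" 1] smult(5)[of a] by simp
    then show "(-1) \<odot> a \<oplus> a = \<zero>"
      using a smult_l_null by simp
  qed (simp_all add: a smult)
  have sub: "submodule (homog A i) scalars A" for i
    by (rule submoduleI) (auto simp: minus homog)
  note bits = prod(1)[where i=0 and j=0, simplified] prod(1)[where i=0 and j=1, simplified]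
    prod(1)[where i=1 and j=0, simplified] prod(1)[where i=1 and j=1, simplified]
  show ?thesis
    by (intro superalgebra.intro superalgebra_axioms.intro module_axioms sub)
      (auto simp: homog prod(2-6) set_add_def set_mult_def bits)
qed

section \<open>Bilinear calculus, the supercommutator, graded subspaces\<close>

context superalgebra
begin

lemma smult_smult: "a \<in> carrier A \<Longrightarrow> r \<odot> (s \<odot> a) = (r * s) \<odot> a"
  using smult_assoc1[of r s a] by simp

lemma smult_distrib_right: "a \<in> carrier A \<Longrightarrow> (r + s) \<odot> a = r \<odot> a \<oplus> s \<odot> a"
  using smult_l_distr[of r s a] by simp

lemma smult_distrib_left: "a \<in> carrier A \<Longrightarrow> b \<in> carrier A \<Longrightarrow> r \<odot> (a \<oplus> b) = r \<odot> a \<oplus> r \<odot> b"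
  using smult_r_distr[of r a b] by simp

lemma smult_1: "a \<in> carrier A \<Longrightarrow> 1 \<odot> a = a"
  using smult_one[of a] by simp

lemma smult_0: "a \<in> carrier A \<Longrightarrow> 0 \<odot> a = \<zero>"
  using smult_l_null[of a] by simp

lemma smult_in_carrier: "a \<in> carrier A \<Longrightarrow> r \<odot> a \<in> carrier A"
  using smult_closed[of r a] by simp

lemma minus_eq_smult: "a \<in> carrier A \<Longrightarrow> b \<in> carrier A \<Longrightarrow> a \<ominus> b = a \<oplus> (-1) \<odot> b"
  by (simp add: a_minus_def minus_one)

lemma homog_closed:
  shows "a \<in> homog A i \<Longrightarrow> b \<in> homog A i \<Longrightarrow> a \<oplus> b \<in> homog A i"
    and "a \<in> homog A i \<Longrightarrow> r \<odot> a \<in> homog A i"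
    and "a \<in> homog A i \<Longrightarrow> b \<in> homog A i \<Longrightarrow> a \<ominus> b \<in> homog A i"
  using submoduleE[OF homog_submodule[of i]] by (auto simp: a_minus_def)

lemma homog_part_add:
  assumes "a \<in> carrier A" "b \<in> carrier A"
  shows "homog_part A i (a \<oplus> b) = homog_part A i a \<oplus> homog_part A i b"
proof (rule homog_part_eqI)
  have "a \<oplus> b = (homog_part A i a \<oplus> homog_part A (i+1) a) \<oplus> (homog_part A i b \<oplus> homog_part A (i+1) b)"
    using homog_part(2) assms by metis
  then show "a \<oplus> b = (homog_part A i a \<oplus> homog_part A i b) \<oplus> (homog_part A (i+1) a \<oplus> homog_part A (i+1) b)"
    by (simp add: assms homog_part_closed M.a_ac)
qed (intro homog_closed homog_part assms)+

lemma homog_part_smult: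
  assumes "a \<in> carrier A"
  shows "homog_part A i (r \<odot> a) = r \<odot> homog_part A i a"
proof (rule homog_part_eqI)
  have "r \<odot> a = r \<odot> (homog_part A i a \<oplus> homog_part A (i+1) a)"
    using homog_part(2)[OF assms] by metis
  then show "r \<odot> a = r \<odot> homog_part A i a \<oplus> r \<odot> homog_part A (i+1) a"
    by (simp add: assms homog_part_closed smult_distrib_left)
qed (intro homog_closed homog_part assms)+

lemmas arith = smult_smult smult_distrib_right smult_distrib_left minus_eq_smult
  prod_l_distr prod_r_distr prod_smult_l prod_smult_r homog_part_add homog_part_smult
  homog_part_closed prod_closed smult_in_carrier M.a_ac

text \<open>The projections to the homogeneous parts are linear, so each of the four parity summands
  of the bracket is bilinear.\<close>

lemma supercommutator_bilinear:
  assumes "a \<in> carrier A" "b \<in> carrier A" "c \<in> carrier A"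
  shows "supercommutator A (a \<oplus> b) c = supercommutator A a c \<oplus> supercommutator A b c"
    and "supercommutator A c (a \<oplus> b) = supercommutator A c a \<oplus> supercommutator A c b"
    and "supercommutator A (r \<odot> a) b = r \<odot> supercommutator A a b"
    and "supercommutator A a (r \<odot> b) = r \<odot> supercommutator A a b"
proof -
  define br where "br i j x y = homog_part A i x \<otimes> homog_part A j y
    \<ominus> sgn2 (i * j) \<odot> (homog_part A j y \<otimes> homog_part A i x)" for i j x y
  have sum: "supercommutator A x y = (br 0 0 x y \<oplus> br 0 1 x y) \<oplus> (br 1 0 x y \<oplus> br 1 1 x y)" for x y
    unfolding supercommutator_def br_def Let_def ..
  have closed: "br i j x y \<in> carrier A" if "x \<in> carrier A" "y \<in> carrier A" for i j x y
    using that by (simp add: br_def prod_closed homog_part_closed smult_in_carrier M.minus_closed)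
  have "br i j (a \<oplus> b) c = br i j a c \<oplus> br i j b c" "br i j c (a \<oplus> b) = br i j c a \<oplus> br i j c b"
    "br i j (r \<odot> a) b = r \<odot> br i j a b" "br i j a (r \<odot> b) = r \<odot> br i j a b" for i j
    using assms by (simp_all add: br_def arith mult.commute)
  then show "supercommutator A (a \<oplus> b) c = supercommutator A a c \<oplus> supercommutator A b c"
    "supercommutator A c (a \<oplus> b) = supercommutator A c a \<oplus> supercommutator A c b"
    "supercommutator A (r \<odot> a) b = r \<odot> supercommutator A a b"
    "supercommutator A a (r \<odot> b) = r \<odot> supercommutator A a b"
    using assms by (simp_all add: sum closed M.a_ac smult_distrib_left smult_in_carrier)
qed

lemma supercommutator_in_homog:
  assumes "a \<in> homog A i" "b \<in> homog A j"
  shows "supercommutator A a b \<in> homog A (i + j)"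
  unfolding supercommutator_homog[OF assms]
  using prod_homog[OF assms] prod_homog[OF assms(2,1)]
  by (auto simp: add.commute intro!: homog_closed)

lemmas homog_bit_products = prod_homog[where i=0 and j=0, simplified] prod_homog[where i=0 and j=1, simplified]
  prod_homog[where i=1 and j=0, simplified] prod_homog[where i=1 and j=1, simplified]

lemmas homog_bit_brackets = supercommutator_in_homog[where i=0 and j=0, simplified]
  supercommutator_in_homog[where i=0 and j=1, simplified]
  supercommutator_in_homog[where i=1 and j=0, simplified]
  supercommutator_in_homog[where i=1 and j=1, simplified]

lemma ex_homog_sum: "a \<in> carrier A \<Longrightarrow> \<exists>b\<in>homog A 0. \<exists>c\<in>homog A 1. a = b \<oplus> c"
  using homog_part[of a 0] homog_part(1)[of a 1] by fastforce

lemma superalgebra_commutator_algebra: "superalgebra (commutator_algebra A)"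
proof -
  have "abelian_group (commutator_algebra A)"
    by (rule abelian_groupI)
      (auto simp: commutator_algebra_def M.a_ac intro!: bexI[of _ "\<ominus> _"] M.l_neg)
  then show ?thesis
    using homog_Int ex_homog_sum
    by (intro superalgebraI)
      (auto simp: commutator_algebra_def homog_bit_brackets smult_in_carrier smult_distrib_right smult_distrib_left
        smult_smult smult_1 homog_carrier zero_homog homog_closed
        supercommutator_bilinear supercommutator_closed)
qed

text \<open>A subspace is the sum of its even and odd parts exactly if it is stable under both
  homogeneous projections. In this form gradedness is a closure condition on single elements, which
  passes to intersections and preimages.\<close>

lemma graded_submodule_iff:
  "submodule I scalars A \<and> I = (I \<inter> homog A 0) <+>\<^bsub>A\<^esub> (I \<inter> homog A 1) \<longleftrightarrow>
    I \<subseteq> carrier A \<and> \<zero> \<in> I \<and> (\<forall>a\<in>I. \<forall>b\<in>I. a \<oplus> b \<in> I) \<and> (\<forall>a\<in>I. \<forall>r. r \<odot> a \<in> I) \<and>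
    (\<forall>a\<in>I. \<forall>i. homog_part A i a \<in> I)" (is "?L \<longleftrightarrow> ?R")
proof
  assume L: ?L
  note sub = submoduleE[OF conjunct1[OF L]]
  obtain z where "z \<in> I" "z \<in> carrier A" using sub(1,2) by auto
  then have "\<zero> \<in> I" using sub(4)[of 0 z] by (simp add: smult_0)
  moreover have "homog_part A i a \<in> I" if "a \<in> I" for i a
  proof -
    have "a \<in> (I \<inter> homog A 0) <+>\<^bsub>A\<^esub> (I \<inter> homog A 1)" using L that by blast
    then obtain b c where bc: "b \<in> I" "b \<in> homog A 0" "c \<in> I" "c \<in> homog A 1" "a = b \<oplus> c"
      unfolding set_add_def set_mult_def by auto
    then have "homog_part A i a = (if i = 0 then b else c)"
      by (cases i) (auto simp: homog_part_add homog_carrier homog_part_homog)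
    then show ?thesis using bc by simp
  qed
  ultimately show ?R using sub by auto
next
  assume R: ?R
  have "submodule I scalars A"
    using R by (intro submoduleI) (auto simp: minus_one subset_iff)
  moreover have "a \<in> (I \<inter> homog A 0) <+>\<^bsub>A\<^esub> (I \<inter> homog A 1)" if "a \<in> I" for a
  proof -
    have "a = homog_part A 0 a \<oplus> homog_part A 1 a" "homog_part A i a \<in> homog A i" for i
      using that R homog_part(2)[of a 0] homog_part(1)[of a i] by auto
    moreover have "homog_part A i a \<in> I" for i using that R by blast
    ultimately show ?thesis unfolding set_add_def set_mult_def by auto
  qed
  moreover have "a \<in> I" if "a \<in> (I \<inter> homog A 0) <+>\<^bsub>A\<^esub> (I \<inter> homog A 1)" for a
    using that R by (auto simp: set_add_def set_mult_def)
  ultimately show ?L by blast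
qed

lemma sub_superalgebra_iff:
  "sub_superalgebra A I \<longleftrightarrow>
    I \<subseteq> carrier A \<and> \<zero> \<in> I \<and> (\<forall>a\<in>I. \<forall>b\<in>I. a \<oplus> b \<in> I) \<and> (\<forall>a\<in>I. \<forall>r. r \<odot> a \<in> I) \<and>
    (\<forall>a\<in>I. \<forall>i. homog_part A i a \<in> I) \<and> (\<forall>a\<in>I. \<forall>b\<in>I. a \<otimes> b \<in> I)"
  using graded_submodule_iff[of I] unfolding sub_superalgebra_def by (simp only: conj_assoc[symmetric])

lemma graded_ideal_iff:
  "graded_ideal A I \<longleftrightarrow>
    I \<subseteq> carrier A \<and> \<zero> \<in> I \<and> (\<forall>a\<in>I. \<forall>b\<in>I. a \<oplus> b \<in> I) \<and> (\<forall>a\<in>I. \<forall>r. r \<odot> a \<in> I) \<and>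
    (\<forall>a\<in>I. \<forall>i. homog_part A i a \<in> I) \<and> (\<forall>a\<in>carrier A. \<forall>x\<in>I. a \<otimes> x \<in> I \<and> x \<otimes> a \<in> I)"
  using graded_submodule_iff[of I] unfolding graded_ideal_def by (simp only: conj_assoc[symmetric])

text \<open>The conditions of \<open>sub_superalgebra_iff\<close> are closure conditions and survive
  intersection. Containment of \<open>S\<close> in the carrier provides a member of the intersected
  family; over an empty family the hull would be the whole type.\<close>

lemma sub_superalgebra_hull:
  assumes "S \<subseteq> carrier A"
  shows "sub_superalgebra A (sub_superalgebra A hull S)"
proof -
  have "sub_superalgebra A (carrier A)"
    by (auto simp: sub_superalgebra_iff smult_in_carrier homog_part_closed prod_closed)
  then show ?thesis
    using assms unfolding hull_def sub_superalgebra_iff by (auto simp: subset_iff)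
qed

lemma graded_ideal_hull:
  assumes "S \<subseteq> carrier A"
  shows "graded_ideal A (graded_ideal A hull S)"
proof -
  have "graded_ideal A (carrier A)"
    by (auto simp: graded_ideal_iff smult_in_carrier homog_part_closed prod_closed)
  then show ?thesis
    using assms unfolding hull_def graded_ideal_iff by (auto simp: subset_iff)
qed

lemma superalgebra_restrict:
  assumes "sub_superalgebra A H"
  shows "superalgebra (restrict_superalgebra A H)"
proof -
  note H = assms[unfolded sub_superalgebra_iff]
  have c: "x \<in> carrier A" if "x \<in> H" for x using H that by blast
  have "abelian_group (restrict_superalgebra A H)"
  proof (rule abelian_groupI)
    fix x assume "x \<in> carrier (restrict_superalgebra A H)"
    then have "x \<in> H" by (simp add: restrict_superalgebra_def)
    then have "x \<in> H" "(-1) \<odot> x \<oplus> x = \<zero>" using H c M.l_neg[of x] minus_one[of x] by auto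
    then show "\<exists>y\<in>carrier (restrict_superalgebra A H).
        y \<oplus>\<^bsub>restrict_superalgebra A H\<^esub> x = \<zero>\<^bsub>restrict_superalgebra A H\<^esub>"
      using H by (intro bexI[of _ "(-1) \<odot> x"]) (auto simp: restrict_superalgebra_def)
  qed (use H c in \<open>auto simp: restrict_superalgebra_def M.a_ac\<close>)
  moreover have "\<exists>b\<in>homog A 0 \<inter> H. \<exists>d\<in>homog A 1 \<inter> H. a = b \<oplus> d" if "a \<in> H" for a
    using H that homog_part[of a 0] homog_part[of a 1] c[OF that]
    by (intro bexI[of _ "homog_part A 0 a"] bexI[of _ "homog_part A 1 a"]) auto
  ultimately show ?thesis
    using H homog_Int c
    by (intro superalgebraI)
      (auto simp: restrict_superalgebra_def smult_in_carrier smult_distrib_right smult_distrib_left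
        smult_smult smult_1 zero_homog homog_closed
        prod_closed prod_l_distr prod_r_distr prod_smult_l prod_smult_r homog_bit_products)
qed

end

text \<open>Applied with the zero ideal to obtain the universal property of the free Zinbiel
  superalgebra, and with the line through yxx to obtain the kernel of the exceptional
  quotient.\<close>

lemma graded_ideal_preimage:
  assumes "superalgebra A" "superalgebra B" "h \<in> superalgebra_hom A B" "graded_ideal B J"
  shows "graded_ideal A {a \<in> carrier A. h a \<in> J}"
proof -
  interpret A: superalgebra A by fact
  interpret B: superalgebra B by fact
  note h = superalgebra_homD[OF assms(3)] superalgebra_hom_part[OF assms(1-3)]
  have "h \<zero>\<^bsub>A\<^esub> = \<zero>\<^bsub>B\<^esub>"
    using h(4)[of "\<zero>\<^bsub>A\<^esub>" 0] A.smult_0 B.smult_0 h(1) by simp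
  then show ?thesis
    using assms(4) unfolding A.graded_ideal_iff B.graded_ideal_iff
    by (auto simp: h A.prod_closed A.smult_in_carrier A.homog_part_closed)
qed

section \<open>Quotients by graded ideals\<close>

context superalgebra
begin

lemma eq_if_minus_eq_zero:
  assumes "a \<in> carrier A" "b \<in> carrier A" "a \<ominus> b = \<zero>"
  shows "a = b"
  using M.minus_equality[of a "\<ominus> b"] assms by (simp add: a_minus_def)

context
  fixes I assumes I: "graded_ideal A I"
begin

lemma ideal_closed:
  shows "a \<in> I \<Longrightarrow> a \<in> carrier A" "\<zero> \<in> I" "a \<in> I \<Longrightarrow> b \<in> I \<Longrightarrow> a \<oplus> b \<in> I"
    "a \<in> I \<Longrightarrow> r \<odot> a \<in> I" "a \<in> I \<Longrightarrow> homog_part A i a \<in> I"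
    "a \<in> I \<Longrightarrow> b \<in> carrier A \<Longrightarrow> a \<otimes> b \<in> I" "a \<in> I \<Longrightarrow> b \<in> carrier A \<Longrightarrow> b \<otimes> a \<in> I"
  using I unfolding graded_ideal_iff by auto

text \<open>The product is not associative, so the calculus of cosets rests on the additive group
  alone; products are treated separately.\<close>

lemma ideal_abelian_subgroup: "abelian_subgroup I A"
  using I unfolding graded_ideal_def submodule_def
  by (intro abelian_subgroupI3 additive_subgroup.intro M.abelian_group_axioms) auto

lemma coset_eq_iff:
  assumes "a \<in> carrier A" "b \<in> carrier A"
  shows "I +> a = I +> b \<longleftrightarrow> a \<ominus> b \<in> I"
proof -
  interpret S: abelian_subgroup I A by (rule ideal_abelian_subgroup)
  show ?thesis
    using S.a_rcos_module[OF assms(2,1)] S.a_repr_independence' S.a_repr_independenceD assms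
    by (metis a_minus_def)
qed

lemma mem_coset_iff:
  assumes "a \<in> carrier A"
  shows "b \<in> I +> a \<longleftrightarrow> b \<in> carrier A \<and> b \<ominus> a \<in> I"
proof -
  interpret S: abelian_subgroup I A by (rule ideal_abelian_subgroup)
  show ?thesis
    using assms S.a_rcos_module[of a b] S.a_elemrcos_carrier by (auto simp: a_minus_def)
qed

lemma quotient_simps:
  shows carrier_quotient: "carrier (quotient_superalgebra A I) = (\<lambda>a. I +> a) ` carrier A"
    and homog_quotient: "homog (quotient_superalgebra A I) i = (\<lambda>a. I +> a) ` homog A i"
    and zero_quotient: "\<zero>\<^bsub>quotient_superalgebra A I\<^esub> = I +> \<zero>"
    and add_quotient: "a \<in> carrier A \<Longrightarrow> b \<in> carrier A \<Longrightarrow>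
      (I +> a) \<oplus>\<^bsub>quotient_superalgebra A I\<^esub> (I +> b) = I +> (a \<oplus> b)"
    and mult_quotient: "a \<in> carrier A \<Longrightarrow> b \<in> carrier A \<Longrightarrow>
      (I +> a) \<otimes>\<^bsub>quotient_superalgebra A I\<^esub> (I +> b) = I +> (a \<otimes> b)"
    and smult_quotient: "a \<in> carrier A \<Longrightarrow>
      r \<odot>\<^bsub>quotient_superalgebra A I\<^esub> (I +> a) = I +> (r \<odot> a)"
proof -
  interpret S: abelian_subgroup I A by (rule ideal_abelian_subgroup)
  show "carrier (quotient_superalgebra A I) = (\<lambda>a. I +> a) ` carrier A"
    unfolding quotient_superalgebra_def FactRing_def by (auto simp: A_RCOSETS_def')
  show "homog (quotient_superalgebra A I) i = (\<lambda>a. I +> a) ` homog A i"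
    by (simp add: quotient_superalgebra_def)
  show "\<zero>\<^bsub>quotient_superalgebra A I\<^esub> = I +> \<zero>"
    using S.a_rcos_const[OF ideal_closed(2)] by (simp add: quotient_superalgebra_def FactRing_def)
  show "(I +> a) \<oplus>\<^bsub>quotient_superalgebra A I\<^esub> (I +> b) = I +> (a \<oplus> b)"
    if "a \<in> carrier A" "b \<in> carrier A"
    using that by (simp add: quotient_superalgebra_def FactRing_def S.a_rcos_sum)
  show "r \<odot>\<^bsub>quotient_superalgebra A I\<^esub> (I +> a) = I +> (r \<odot> a)" if a: "a \<in> carrier A"
  proof -
    have "I +> (r \<odot> b) = I +> (r \<odot> a)" if "b \<in> I +> a" for b
    proof -
      have b: "b \<in> carrier A" "b \<ominus> a \<in> I"
        using that a by (auto simp: mem_coset_iff)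
      then have "r \<odot> (b \<ominus> a) \<in> I" by (intro ideal_closed)
      then show ?thesis using a b by (simp add: coset_eq_iff arith mult.commute)
    qed
    moreover have "a \<in> I +> a" using a by (simp add: mem_coset_iff a_minus_def M.r_neg ideal_closed)
    \<comment> \<open>The operation on cosets is a union over representatives; all of its members
      are the same coset, and there is at least one.\<close>
    ultimately have "(\<Union>b\<in>I +> a. I +> (r \<odot> b)) = I +> (r \<odot> a)" by (intro SUP_eq_const) blast+
    then show ?thesis by (simp add: quotient_superalgebra_def)
  qed
  show "(I +> a) \<otimes>\<^bsub>quotient_superalgebra A I\<^esub> (I +> b) = I +> (a \<otimes> b)"
    if ab: "a \<in> carrier A" "b \<in> carrier A"
  proof -
    have "I +> (c \<otimes> d) = I +> (a \<otimes> b)" if "c \<in> I +> a" "d \<in> I +> b" for c d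
    proof -
      have c: "c \<in> carrier A" "c \<ominus> a \<in> I" and d: "d \<in> carrier A" "d \<ominus> b \<in> I"
        using that ab by (auto simp: mem_coset_iff)
      \<comment> \<open>One factor is exchanged at a time: cd - ab = (c - a)d + a(d - b), and both
        summands lie in the ideal.\<close>
      have "(c \<ominus> a) \<otimes> d \<in> I" using c d by (intro ideal_closed(6))
      then have "I +> (c \<otimes> d) = I +> (a \<otimes> d)"
        using ab c d by (simp add: coset_eq_iff arith)
      moreover have "a \<otimes> (d \<ominus> b) \<in> I" using ab d by (intro ideal_closed(7))
      then have "I +> (a \<otimes> d) = I +> (a \<otimes> b)"
        using ab c d by (simp add: coset_eq_iff arith)
      ultimately show ?thesis by simp
    qed
    moreover have "a \<in> I +> a" "b \<in> I +> b" using ab by (simp_all add: mem_coset_iff a_minus_def M.r_neg ideal_closed)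
    ultimately have "(\<Union>c\<in>I +> a. \<Union>d\<in>I +> b. I +> (c \<otimes> d)) = I +> (a \<otimes> b)"
      by (intro SUP_eq_const) blast+
    then show ?thesis by (simp add: quotient_superalgebra_def FactRing_def rcoset_mult_def)
  qed
qed

lemma superalgebra_quotient: "superalgebra (quotient_superalgebra A I)"
proof -
  let ?Q = "quotient_superalgebra A I"
  have "abelian_group ?Q"
  proof (rule abelian_groupI)
    fix x assume "x \<in> carrier ?Q"
    then obtain a where a: "a \<in> carrier A" "x = I +> a" by (auto simp: carrier_quotient)
    then show "\<exists>y\<in>carrier ?Q. y \<oplus>\<^bsub>?Q\<^esub> x = \<zero>\<^bsub>?Q\<^esub>"
      by (intro bexI[of _ "I +> (\<ominus> a)"]) (auto simp: quotient_simps M.l_neg)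
  qed (auto simp: quotient_simps M.a_ac)
  \<comment> \<open>Here the grading of \<open>I\<close> enters: if an even \<open>a\<close> and an
    odd \<open>b\<close> have the same coset, the even part of a - b, which is \<open>a\<close>,
    lies in \<open>I\<close>.\<close>
  moreover have "I +> a = I +> \<zero>" if "I +> a = I +> b" "a \<in> homog A 0" "b \<in> homog A 1" for a b
  proof -
    have "a \<ominus> b \<in> I" using that by (simp add: coset_eq_iff homog_carrier)
    then have "homog_part A 0 (a \<ominus> b) \<in> I" by (rule ideal_closed)
    moreover have "homog_part A 0 (a \<ominus> b) = a \<ominus> \<zero>"
      using that homog_carrier by (simp add: arith homog_part_homog smult_r_null[of "-1", simplified])
    ultimately show ?thesis using that homog_carrier by (simp add: coset_eq_iff)
  qed
  moreover have "\<exists>b\<in>homog A 0. \<exists>c\<in>homog A 1. I +> a = I +> (b \<oplus> c)" if "a \<in> carrier A" for a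
    using ex_homog_sum[OF that] by metis
  ultimately show ?thesis
    by (intro superalgebraI)
      (auto simp: quotient_simps smult_in_carrier smult_distrib_right smult_distrib_left
        smult_smult smult_1 zero_homog homog_closed homog_carrier
        prod_closed prod_l_distr prod_r_distr prod_smult_l prod_smult_r homog_bit_products)
qed

lemma quotient_hom: "(\<lambda>a. I +> a) \<in> superalgebra_hom A (quotient_superalgebra A I)"
  by (auto simp: superalgebra_hom_def quotient_simps)

lemma hom_factors_through_quotient:
  assumes B: "superalgebra B" and h: "h \<in> superalgebra_hom A B" and ker: "\<And>a. a \<in> I \<Longrightarrow> h a = \<zero>\<^bsub>B\<^esub>"
  obtains k where "k \<in> superalgebra_hom (quotient_superalgebra A I) B"
    "\<And>a. a \<in> carrier A \<Longrightarrow> k (I +> a) = h a"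
proof -
  interpret B: superalgebra B by fact
  have eq: "h a = h b" if "a \<in> carrier A" "b \<in> carrier A" "I +> a = I +> b" for a b
  proof -
    have "h a \<ominus>\<^bsub>B\<^esub> h b = \<zero>\<^bsub>B\<^esub>"
      using that ker[of "a \<ominus> b"] superalgebra_hom_minus[OF superalgebra_axioms B h that(1,2)]
      by (simp add: coset_eq_iff)
    then show ?thesis using B.eq_if_minus_eq_zero superalgebra_homD(1)[OF h] that by blast
  qed
  define k where "k C = h (SOME a. a \<in> carrier A \<and> I +> a = C)" for C
  have k: "k (I +> a) = h a" if "a \<in> carrier A" for a
    unfolding k_def using that
    using someI[of "\<lambda>b. b \<in> carrier A \<and> I +> b = I +> a" a] by (intro eq) auto
  have "k \<in> superalgebra_hom (quotient_superalgebra A I) B"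
    using superalgebra_homD[OF h]
    by (auto simp: superalgebra_hom_def quotient_simps k homog_carrier smult_in_carrier prod_closed)
  then show ?thesis using k that by blast
qed

text \<open>Every homogeneous coset has a homogeneous representative of the same parity, so
  identities between homogeneous elements descend along the quotient map.\<close>

lemma tortkara_quotient:
  assumes "tortkara A"
  shows "tortkara (quotient_superalgebra A I)"
proof -
  interpret T: tortkara A by fact
  interpret Q: superalgebra "quotient_superalgebra A I" by (rule superalgebra_quotient)
  note minus = superalgebra_hom_minus[OF superalgebra_axioms superalgebra_quotient quotient_hom]
  have uminus: "\<ominus>\<^bsub>quotient_superalgebra A I\<^esub> (I +> a) = I +> (\<ominus> a)" if "a \<in> carrier A" for a
    using that superalgebra_homD(1)[OF quotient_hom that]
    by (simp add: minus_one Q.minus_one smult_quotient)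
  have jac: "super_jacobian (quotient_superalgebra A I) j k (I +> a) (I +> b) (I +> c) =
      I +> super_jacobian A j k a b c" if "a \<in> carrier A" "b \<in> carrier A" "c \<in> carrier A" for j k a b c
    using that unfolding super_jacobian_def
    by (simp add: mult_quotient smult_quotient minus prod_closed smult_in_carrier M.minus_closed)
  have jac_closed: "super_jacobian A j k a b c \<in> carrier A"
    if "a \<in> carrier A" "b \<in> carrier A" "c \<in> carrier A" for j k a b c
    using that unfolding super_jacobian_def
    by (simp add: prod_closed smult_in_carrier M.minus_closed)
  show ?thesis
  proof (intro tortkara.intro tortkara_axioms.intro superalgebra_quotient)
    fix x y i j
    assume "x \<in> homog (quotient_superalgebra A I) i" "y \<in> homog (quotient_superalgebra A I) j"
    then obtain a b where "a \<in> homog A i" "b \<in> homog A j" "x = I +> a" "y = I +> b"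
      by (auto simp: homog_quotient)
    then show "x \<otimes>\<^bsub>quotient_superalgebra A I\<^esub> y = \<ominus>\<^bsub>quotient_superalgebra A I\<^esub>
        (sgn2 (i * j) \<odot>\<^bsub>quotient_superalgebra A I\<^esub> (y \<otimes>\<^bsub>quotient_superalgebra A I\<^esub> x))"
      using T.super_anticommutative[of a i b j]
      by (simp add: mult_quotient smult_quotient uminus homog_carrier prod_closed smult_in_carrier)
  next
    fix x y z w i j k l
    let ?Q = "quotient_superalgebra A I"
    assume "x \<in> homog ?Q i" "y \<in> homog ?Q j" "z \<in> homog ?Q k" "w \<in> homog ?Q l"
    then obtain a b c d where abcd: "a \<in> homog A i" "b \<in> homog A j" "c \<in> homog A k" "d \<in> homog A l"
      "x = I +> a" "y = I +> b" "z = I +> c" "w = I +> d"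
      by (auto simp: homog_quotient)
    then show "x \<otimes>\<^bsub>?Q\<^esub> y \<otimes>\<^bsub>?Q\<^esub> (z \<otimes>\<^bsub>?Q\<^esub> w) \<ominus>\<^bsub>?Q\<^esub>
          sgn2 (l * (j + k)) \<odot>\<^bsub>?Q\<^esub> (x \<otimes>\<^bsub>?Q\<^esub> w \<otimes>\<^bsub>?Q\<^esub> (y \<otimes>\<^bsub>?Q\<^esub> z)) =
        super_jacobian ?Q j k x y z \<otimes>\<^bsub>?Q\<^esub> w \<oplus>\<^bsub>?Q\<^esub>
          sgn2 (i * j) \<odot>\<^bsub>?Q\<^esub> (y \<otimes>\<^bsub>?Q\<^esub> super_jacobian ?Q k l x z w)"
      using T.tortkara_identity[OF abcd(1-4)]
      by (simp add: mult_quotient smult_quotient add_quotient minus[symmetric] jac jac_closed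
        homog_carrier prod_closed smult_in_carrier)
  qed
qed

lemma zinbiel_quotient:
  assumes "zinbiel_relations A \<subseteq> I"
  shows "zinbiel (quotient_superalgebra A I)"
proof (intro zinbiel.intro zinbiel_axioms.intro superalgebra_quotient)
  fix x y z i j k
  let ?Q = "quotient_superalgebra A I"
  assume "x \<in> homog ?Q i" "y \<in> homog ?Q j" "z \<in> homog ?Q k"
  then obtain a b c where abc: "a \<in> homog A i" "b \<in> homog A j" "c \<in> homog A k"
    "x = I +> a" "y = I +> b" "z = I +> c"
    by (auto simp: homog_quotient)
  then have "a \<otimes> (b \<otimes> c) \<ominus> ((a \<otimes> b) \<otimes> c \<oplus> sgn2 (i * j) \<odot> ((b \<otimes> a) \<otimes> c)) \<in> I"
    using assms unfolding zinbiel_relations_def by blast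
  then have "I +> (a \<otimes> (b \<otimes> c)) = I +> ((a \<otimes> b) \<otimes> c \<oplus> sgn2 (i * j) \<odot> ((b \<otimes> a) \<otimes> c))"
    using abc by (subst coset_eq_iff) (auto simp: homog_carrier prod_closed smult_in_carrier)
  then show "x \<otimes>\<^bsub>?Q\<^esub> (y \<otimes>\<^bsub>?Q\<^esub> z) =
      x \<otimes>\<^bsub>?Q\<^esub> y \<otimes>\<^bsub>?Q\<^esub> z \<oplus>\<^bsub>?Q\<^esub> sgn2 (i * j) \<odot>\<^bsub>?Q\<^esub> (y \<otimes>\<^bsub>?Q\<^esub> x \<otimes>\<^bsub>?Q\<^esub> z)"
    using abc by (simp add: quotient_simps homog_carrier prod_closed smult_in_carrier)
qed

end

end

lemma tortkara_restrict:
  assumes "tortkara A" "sub_superalgebra A H"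
  shows "tortkara (restrict_superalgebra A H)"
proof -
  interpret T: tortkara A by fact
  interpret R: superalgebra "restrict_superalgebra A H" by (rule T.superalgebra_restrict[OF assms(2)])
  note H = assms(2)[unfolded T.sub_superalgebra_iff]
  have c: "x \<in> carrier A" if "x \<in> H" for x using H that by blast
  \<comment> \<open>The negative is a description over the carrier, so shrinking the carrier could
    change it; on both sides it is multiplication by -1.\<close>
  have uminus: "\<ominus>\<^bsub>restrict_superalgebra A H\<^esub> a = \<ominus>\<^bsub>A\<^esub> a" if "a \<in> H" for a
    using that c R.minus_one[of a] T.minus_one[of a] by (simp add: restrict_superalgebra_def)
  have minus: "a \<ominus>\<^bsub>restrict_superalgebra A H\<^esub> b = a \<ominus>\<^bsub>A\<^esub> b" if "b \<in> H" for a b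
    using that uminus[of b] by (simp add: a_minus_def restrict_superalgebra_def)
  have minus_closed: "a \<ominus>\<^bsub>A\<^esub> b \<in> H" if "a \<in> H" "b \<in> H" for a b
    using that H c by (simp add: T.minus_eq_smult)
  note [simp] = uminus minus minus_closed
  have jac: "super_jacobian (restrict_superalgebra A H) j k a b c = super_jacobian A j k a b c"
      and jac_closed: "super_jacobian A j k a b c \<in> H"
    if "a \<in> H" "b \<in> H" "c \<in> H" for j k a b c
    using that H unfolding super_jacobian_def
    by (simp_all add: restrict_superalgebra_def[of A H] minus[unfolded restrict_superalgebra_def])
  let ?R = "restrict_superalgebra A H"
  have simps: "a \<oplus>\<^bsub>?R\<^esub> b = a \<oplus>\<^bsub>A\<^esub> b" "a \<otimes>\<^bsub>?R\<^esub> b = a \<otimes>\<^bsub>A\<^esub> b"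
    "r \<odot>\<^bsub>?R\<^esub> a = r \<odot>\<^bsub>A\<^esub> a" "homog ?R i = homog A i \<inter> H" for a b r i
    by (simp_all add: restrict_superalgebra_def)
  have closed: "a \<in> H \<Longrightarrow> b \<in> H \<Longrightarrow> a \<otimes>\<^bsub>A\<^esub> b \<in> H" "a \<in> H \<Longrightarrow> r \<odot>\<^bsub>A\<^esub> a \<in> H" for a b r
    using H by auto
  show ?thesis
  proof (intro tortkara.intro tortkara_axioms.intro R.superalgebra_axioms)
    fix a b i j assume "a \<in> homog ?R i" "b \<in> homog ?R j"
    then show "a \<otimes>\<^bsub>?R\<^esub> b = \<ominus>\<^bsub>?R\<^esub> (sgn2 (i * j) \<odot>\<^bsub>?R\<^esub> (b \<otimes>\<^bsub>?R\<^esub> a))"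
      using T.super_anticommutative[of a i b j] by (simp add: simps closed)
  next
    fix a b c d i j k l
    assume "a \<in> homog ?R i" "b \<in> homog ?R j" "c \<in> homog ?R k" "d \<in> homog ?R l"
    then show "a \<otimes>\<^bsub>?R\<^esub> b \<otimes>\<^bsub>?R\<^esub> (c \<otimes>\<^bsub>?R\<^esub> d) \<ominus>\<^bsub>?R\<^esub>
          sgn2 (l * (j + k)) \<odot>\<^bsub>?R\<^esub> (a \<otimes>\<^bsub>?R\<^esub> d \<otimes>\<^bsub>?R\<^esub> (b \<otimes>\<^bsub>?R\<^esub> c)) =
        super_jacobian ?R j k a b c \<otimes>\<^bsub>?R\<^esub> d \<oplus>\<^bsub>?R\<^esub>
          sgn2 (i * j) \<odot>\<^bsub>?R\<^esub> (b \<otimes>\<^bsub>?R\<^esub> super_jacobian ?R k l a c d)"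
      using T.tortkara_identity[of a i b j c k d l] by (simp add: simps closed jac)
  qed
qed

lemma (in superalgebra) hom_restrict:
  "h \<in> superalgebra_hom A B \<Longrightarrow> sub_superalgebra A H \<Longrightarrow> h \<in> superalgebra_hom (restrict_superalgebra A H) B"
  unfolding superalgebra_hom_def sub_superalgebra_iff restrict_superalgebra_def
  by (auto simp: Pi_iff subset_iff image_subset_iff)

section \<open>Calculations with half-shuffles\<close>

text \<open>
  A word is listed from its last letter to its first and stands for the left-normed product
  of its letters. A list of words with coefficients stands for a linear combination.
\<close>

definition word_parity :: "('l \<Rightarrow> bit) \<Rightarrow> 'l list \<Rightarrow> bit" where
  "word_parity par w = sum_list (map par w)"

text \<open>Signs and coefficients are kept in the integers, so that one evaluation by rewriting
  serves every ground field.\<close>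

definition sgn_int :: "bit \<Rightarrow> int" where
  "sgn_int p = (if p = 0 then 1 else -1)"

definition scale_words :: "int \<Rightarrow> ('l list \<times> int) list \<Rightarrow> ('l list \<times> int) list" where
  "scale_words c xs = map (\<lambda>(w, d). (w, c * d)) xs"

text \<open>The Zinbiel identity u(wz) = (uw)z + s(wu)z, with sign s, read as a rewriting rule: the
  last letter z stays last, and the two remaining products are shorter. The second one has its
  factors exchanged, so only the total length decreases. The empty word acts as a left unit
  here.\<close>

function half_shuffle :: "('l \<Rightarrow> bit) \<Rightarrow> 'l list \<Rightarrow> 'l list \<Rightarrow> ('l list \<times> int) list" where
  "half_shuffle par u [] = []"
| "half_shuffle par u [z] = [(z # u, 1)]"
| "half_shuffle par u (z # y # w) = map (\<lambda>(x, c). (z # x, c))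
     (half_shuffle par u (y # w) @
      scale_words (sgn_int (word_parity par u * word_parity par (y # w))) (half_shuffle par (y # w) u))"
  by pat_completeness auto
termination by (relation "measure (\<lambda>(par, u, w). length u + length w)") auto

definition words_mult :: "('l \<Rightarrow> bit) \<Rightarrow> ('l list \<times> int) list \<Rightarrow> ('l list \<times> int) list \<Rightarrow> ('l list \<times> int) list" where
  "words_mult par xs ys =
     concat (map (\<lambda>(u, c). concat (map (\<lambda>(w, d). scale_words (c * d) (half_shuffle par u w)) ys)) xs)"

text \<open>The argument \<open>p\<close> stands for the product of the parities of the two factors.
  The parity of the result does not depend on it, but agreement with the bracket of A does.\<close>

definition words_bracket ::
  "('l \<Rightarrow> bit) \<Rightarrow> bit \<Rightarrow> ('l list \<times> int) list \<Rightarrow> ('l list \<times> int) list \<Rightarrow> ('l list \<times> int) list" where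
  "words_bracket par p xs ys = words_mult par xs ys @ scale_words (- sgn_int p) (words_mult par ys xs)"

definition words_coeff :: "('l list \<times> int) list \<Rightarrow> 'l list \<Rightarrow> int" where
  "words_coeff xs w = sum_list (map (\<lambda>(x, c). if x = w then c else 0) xs)"

definition words_vanish :: "('l list \<times> int) list \<Rightarrow> bool" where
  "words_vanish xs = list_all (\<lambda>w. words_coeff xs w = 0) (remdups (map fst xs))"

text \<open>Empty words are excluded because they evaluate to zero, whereas
  \<open>half_shuffle\<close> treats an empty left factor as a unit.\<close>

definition words_homog :: "('l \<Rightarrow> bit) \<Rightarrow> bit \<Rightarrow> ('l list \<times> int) list \<Rightarrow> bool" where
  "words_homog par i xs \<longleftrightarrow> (\<forall>(w, c)\<in>set xs. w \<noteq> [] \<and> word_parity par w = i)"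

lemma of_int_sgn_int: "of_int (sgn_int p) = sgn2 p"
  by (simp add: sgn_int_def sgn2_def)

lemma half_shuffle_parity:
  "(x, c) \<in> set (half_shuffle par u w) \<Longrightarrow>
    x \<noteq> [] \<and> word_parity par x = word_parity par u + word_parity par w"
  by (induction par u w arbitrary: x c rule: half_shuffle.induct)
    (auto simp: word_parity_def scale_words_def add_ac)

lemma words_homog_append: "words_homog par i (xs @ ys) \<longleftrightarrow> words_homog par i xs \<and> words_homog par i ys"
  by (auto simp: words_homog_def)

lemma words_homog_scale: "words_homog par i xs \<Longrightarrow> words_homog par i (scale_words c xs)"
  by (auto simp: words_homog_def scale_words_def)

lemma words_homog_mult:
  assumes "words_homog par i xs" "words_homog par j ys"
  shows "words_homog par (i + j) (words_mult par xs ys)"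
  using assms unfolding words_homog_def words_mult_def scale_words_def
  by (fastforce dest: half_shuffle_parity)

lemma words_homog_bracket:
  assumes "words_homog par i xs" "words_homog par j ys"
  shows "words_homog par (i + j) (words_bracket par p xs ys)"
  unfolding words_bracket_def words_homog_append
  using words_homog_mult[OF assms] words_homog_mult[OF assms(2,1), unfolded add.commute[of j i]]
  by (intro conjI words_homog_scale)

definition words_jacobian ::
  "('l \<Rightarrow> bit) \<Rightarrow> bit \<Rightarrow> bit \<Rightarrow> bit \<Rightarrow>
    ('l list \<times> int) list \<Rightarrow> ('l list \<times> int) list \<Rightarrow> ('l list \<times> int) list \<Rightarrow> ('l list \<times> int) list" where
  "words_jacobian par i j k x y z =
     words_bracket par ((i + j) * k) (words_bracket par (i * j) x y) z @
     scale_words (-1) (words_bracket par (i * (j + k)) x (words_bracket par (j * k) y z)) @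
     scale_words (- sgn_int (j * k)) (words_bracket par ((i + k) * j) (words_bracket par (i * k) x z) y)"

definition words_tortkara :: "bit \<Rightarrow> bit \<Rightarrow> bit \<Rightarrow> bit \<Rightarrow> (nat list \<times> int) list" where
  "words_tortkara i j k l =
    (let par = (!) [i, j, k, l]; br = words_bracket par;
         a = [([0], 1)]; b = [([1], 1)]; c = [([2], 1)]; d = [([3], 1)]
     in br ((i + j) * (k + l)) (br (i * j) a b) (br (k * l) c d) @
        scale_words (- sgn_int (l * (j + k))) (br ((i + l) * (j + k)) (br (i * l) a d) (br (j * k) b c)) @
        scale_words (-1) (br ((i + j + k) * l) (words_jacobian par i j k a b c) d) @
        scale_words (- sgn_int (i * j)) (br (j * (i + k + l)) b (words_jacobian par i k l a c d)))"

text \<open>Four distinct letters stand for arbitrary homogeneous elements, so the sixteen parity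
  patterns cover the whole identity. In each of them the coefficient of every word cancels, a finite
  computation.\<close>

lemma words_vanish_tortkara: "words_vanish (words_tortkara i j k l)"
proof -
  have "\<forall>i\<in>{0, 1}. \<forall>j\<in>{0, 1}. \<forall>k\<in>{0, 1}. \<forall>l\<in>{0, 1}. words_vanish (words_tortkara i j k l)"
    by code_simp
  moreover have "p \<in> {0, 1}" for p :: bit by (cases p) auto
  ultimately show ?thesis by blast
qed

lemma words_homog_jacobian:
  assumes "words_homog par i x" "words_homog par j y" "words_homog par k z"
  shows "words_homog par (i + j + k) (words_jacobian par i j k x y z)"
proof -
  note br = words_homog_bracket
  have "words_homog par (i + j + k) (words_bracket par p (words_bracket par q x y) z)"
    "words_homog par (i + (j + k)) (words_bracket par p x (words_bracket par q y z))"
    "words_homog par (i + k + j) (words_bracket par p (words_bracket par q x z) y)" for p q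
    by (intro br assms)+
  moreover have "i + (j + k) = i + j + k" "i + k + j = i + j + k" by (simp_all only: add_ac)
  ultimately show ?thesis
    unfolding words_jacobian_def words_homog_append
    by (metis words_homog_scale)
qed

section \<open>Evaluation of words in a Zinbiel superalgebra\<close>

context zinbiel
begin

lemma minus_commutator_algebra: "a \<ominus>\<^bsub>commutator_algebra A\<^esub> b = a \<ominus> b"
  by (simp add: a_minus_def a_inv_def m_inv_def commutator_algebra_def)

context
  fixes v :: "'l \<Rightarrow> 'a" and par :: "'l \<Rightarrow> bit"
  assumes v: "v z \<in> homog A (par z)"
begin

fun word_eval :: "'l list \<Rightarrow> 'a" where
  "word_eval [] = \<zero>"
| "word_eval [z] = v z"
| "word_eval (z # y # w) = word_eval (y # w) \<otimes> v z"

primrec words_eval :: "('l list \<times> int) list \<Rightarrow> 'a" where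
  "words_eval [] = \<zero>"
| "words_eval (x # xs) = of_int (snd x) \<odot> word_eval (fst x) \<oplus> words_eval xs"

lemma words_eval_letter: "words_eval [([z], 1)] = v z"
  by (simp add: smult_1 homog_carrier[OF v])

lemma word_eval_homog: "w \<noteq> [] \<Longrightarrow> word_eval w \<in> homog A (word_parity par w)"
proof (induction w rule: word_eval.induct)
  case (3 z y w)
  have "word_parity par (z # y # w) = word_parity par (y # w) + par z"
    unfolding word_parity_def by (simp only: list.map sum_list.Cons add.commute)
  then show ?case
    using prod_homog[OF 3(1) v, of z] by (simp only: word_eval.simps list.distinct simp_thms)
next
  case (2 z)
  have "word_parity par [z] = par z" unfolding word_parity_def by (simp only: list.map sum_list_simps add_0_right)
  then show ?case by (simp only: word_eval.simps v)
qed simp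

lemma word_eval_closed: "word_eval w \<in> carrier A"
  using word_eval_homog[of w] homog_carrier by (cases "w = []") auto

lemma words_eval_closed: "words_eval xs \<in> carrier A"
  by (induction xs) (auto simp: word_eval_closed smult_in_carrier)

lemma words_eval_append: "words_eval (xs @ ys) = words_eval xs \<oplus> words_eval ys"
  by (induction xs) (auto simp: word_eval_closed words_eval_closed smult_in_carrier M.a_assoc)

lemma words_eval_scale: "words_eval (scale_words c xs) = of_int c \<odot> words_eval xs"
  by (induction xs)
    (auto simp: scale_words_def word_eval_closed words_eval_closed smult_in_carrier smult_distrib_left
      smult_smult smult_r_null[of "of_int c", simplified])

lemma words_eval_homog: "words_homog par i xs \<Longrightarrow> words_eval xs \<in> homog A i"
proof (induction xs)
  case (Cons x xs)
  then show ?case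
    using word_eval_homog[of "fst x"]
    by (cases x) (auto simp: words_homog_def intro!: homog_closed)
qed (simp add: zero_homog)

text \<open>The head of a list is the last letter of the word, hence the outermost right factor.
  Nonemptiness matters: the empty word has value zero, but prefixing \<open>z\<close> to it gives
  the value \<open>v z\<close>.\<close>

lemma words_eval_snoc:
  assumes "\<forall>(w, c)\<in>set xs. w \<noteq> []"
  shows "words_eval (map (\<lambda>(w, c). (z # w, c)) xs) = words_eval xs \<otimes> v z"
  using assms
proof (induction xs)
  case (Cons x xs)
  obtain y w c where "x = (y # w, c)" using Cons.prems by (cases x) (auto simp: neq_Nil_conv)
  then show ?case
    using Cons v[THEN homog_carrier]
    by (simp add: prod_l_distr prod_smult_l word_eval_closed words_eval_closed smult_in_carrier prod_closed)
qed (simp add: prod_zero homog_carrier[OF v])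

text \<open>Follows the recursion of \<open>half_shuffle\<close> through the Zinbiel identity. The
  induction is on the total length because the second recursive call exchanges the two
  words.\<close>

lemma words_eval_half_shuffle:
  "u \<noteq> [] \<Longrightarrow> w \<noteq> [] \<Longrightarrow> words_eval (half_shuffle par u w) = word_eval u \<otimes> word_eval w"
proof (induction "length u + length w" arbitrary: u w rule: less_induct)
  case less
  obtain z w' where w: "w = z # w'" using less.prems by (cases w) auto
  show ?case
  proof (cases w')
    case Nil
    then show ?thesis using less.prems w
      using prod_closed[OF word_eval_closed[of u] homog_carrier[OF v, of z]]
      by (cases u) (auto simp: smult_1)
  next
    case (Cons y x)
    have ne: "\<forall>(r, c)\<in>set (half_shuffle par u w' @
        scale_words (sgn_int (word_parity par u * word_parity par w')) (half_shuffle par w' u)). r \<noteq> []"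
      by (auto simp: scale_words_def dest: half_shuffle_parity)
    define s :: 'b where "s = sgn2 (word_parity par u * word_parity par w')"
    have zin: "word_eval u \<otimes> (word_eval w' \<otimes> v z) =
        (word_eval u \<otimes> word_eval w') \<otimes> v z \<oplus> s \<odot> ((word_eval w' \<otimes> word_eval u) \<otimes> v z)"
      unfolding s_def using less.prems Cons
      by (intro zinbiel_identity[OF word_eval_homog word_eval_homog v]) auto
    have "words_eval (half_shuffle par u w) =
        (word_eval u \<otimes> word_eval w' \<oplus> s \<odot> (word_eval w' \<otimes> word_eval u)) \<otimes> v z"
      using less.hyps[of u w'] less.hyps[of w' u] less.prems words_eval_snoc[OF ne, of z]
      by (simp add: w Cons words_eval_append words_eval_scale s_def flip: of_int_sgn_int)
    also have "\<dots> = word_eval u \<otimes> (word_eval w' \<otimes> v z)"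
      by (simp add: zin prod_l_distr prod_smult_l word_eval_closed smult_in_carrier prod_closed homog_carrier[OF v])
    finally show ?thesis by (simp add: w Cons)
  qed
qed

lemma words_eval_mult:
  assumes "words_homog par i xs" "words_homog par j ys"
  shows "words_eval (words_mult par xs ys) = words_eval xs \<otimes> words_eval ys"
proof -
  have inner: "words_eval (concat (map (\<lambda>(w, d). scale_words (c * d) (half_shuffle par u w)) ys)) =
      of_int c \<odot> (word_eval u \<otimes> words_eval ys)" if "u \<noteq> []" for u c
    using assms(2)
  proof (induction ys)
    case Nil
    then show ?case
      by (simp add: prod_zero word_eval_closed smult_r_null[of "of_int c", simplified])
  next
    case (Cons y ys)
    then show ?case using that
      by (cases y) (simp add: words_homog_def words_eval_append words_eval_scale words_eval_half_shuffle
        word_eval_closed words_eval_closed smult_in_carrier prod_closed prod_r_distr smult_distrib_left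
        smult_smult prod_smult_r)
  qed
  show ?thesis using assms(1) unfolding words_mult_def
  proof (induction xs)
    case Nil
    then show ?case by (simp add: prod_zero words_eval_closed)
  next
    case (Cons x xs)
    then show ?case
      by (cases x) (simp add: words_homog_def words_eval_append inner word_eval_closed words_eval_closed
        smult_in_carrier prod_l_distr prod_smult_l)
  qed
qed

lemma words_eval_bracket:
  assumes "words_homog par i xs" "words_homog par j ys"
  shows "supercommutator A (words_eval xs) (words_eval ys) = words_eval (words_bracket par (i * j) xs ys)"
  unfolding supercommutator_homog[OF assms[THEN words_eval_homog]] words_bracket_def
  by (simp add: words_eval_append words_eval_scale words_eval_mult[OF assms] words_eval_mult[OF assms(2,1)]
    minus_eq_smult of_int_sgn_int smult_smult prod_closed words_eval_closed smult_in_carrier)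

lemma words_eval_filter:
  "words_eval xs = of_int (words_coeff xs w) \<odot> word_eval w \<oplus> words_eval (filter (\<lambda>x. fst x \<noteq> w) xs)"
  by (induction xs)
    (auto simp: words_coeff_def smult_0 smult_distrib_right word_eval_closed words_eval_closed
      smult_in_carrier M.a_ac)

text \<open>Equal words are collected: all occurrences of the first word are split off with their
  total coefficient, which is zero, and the shorter remainder still has only zero
  coefficients.\<close>

lemma words_eval_vanish:
  assumes "words_vanish xs"
  shows "words_eval xs = \<zero>"
proof -
  have "\<forall>w. words_coeff xs w = 0 \<Longrightarrow> words_eval xs = \<zero>" for xs
  proof (induction "length xs" arbitrary: xs rule: less_induct)
    case less
    show ?case
    proof (cases xs)
      case (Cons x ys)
      let ?ys = "filter (\<lambda>y. fst y \<noteq> fst x) xs"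
      have "length ?ys < length xs" using Cons length_filter_le[of _ ys] by (simp add: less_Suc_eq_le)
      moreover have "words_coeff ?ys w = (if w = fst x then 0 else words_coeff xs w)" for w
        unfolding words_coeff_def by (induction xs) auto
      ultimately have "words_eval ?ys = \<zero>" using less by simp
      then show ?thesis
        using words_eval_filter[of xs "fst x"] less.prems by (simp add: smult_0 word_eval_closed)
    qed simp
  qed
  moreover have "words_coeff xs w = 0" for w
  proof (cases "w \<in> set (map fst xs)")
    case True
    then show ?thesis using assms by (auto simp: words_vanish_def list_all_iff)
  next
    case False
    then show ?thesis unfolding words_coeff_def by (induction xs) auto
  qed
  ultimately show ?thesis by blast
qed

lemma words_eval_jacobian:
  assumes "words_homog par i x" "words_homog par j y" "words_homog par k z"
  shows "super_jacobian (commutator_algebra A) j k (words_eval x) (words_eval y) (words_eval z) =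
    words_eval (words_jacobian par i j k x y z)"
proof -
  note br = words_eval_bracket words_homog_bracket
  have "supercommutator A (supercommutator A (words_eval x) (words_eval y)) (words_eval z) =
      words_eval (words_bracket par ((i + j) * k) (words_bracket par (i * j) x y) z)"
    by (simp only: br(1)[OF assms(1,2)] br(1)[OF br(2)[OF assms(1,2)] assms(3)])
  moreover have "supercommutator A (words_eval x) (supercommutator A (words_eval y) (words_eval z)) =
      words_eval (words_bracket par (i * (j + k)) x (words_bracket par (j * k) y z))"
    by (simp only: br(1)[OF assms(2,3)] br(1)[OF assms(1) br(2)[OF assms(2,3)]])
  moreover have "supercommutator A (supercommutator A (words_eval x) (words_eval z)) (words_eval y) =
      words_eval (words_bracket par ((i + k) * j) (words_bracket par (i * k) x z) y)"
    by (simp only: br(1)[OF assms(1,3)] br(1)[OF br(2)[OF assms(1,3)] assms(2)])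
  ultimately show ?thesis
    unfolding super_jacobian_def words_jacobian_def minus_commutator_algebra
    by (simp add: commutator_algebra_def words_eval_append words_eval_scale minus_eq_smult
      words_eval_closed smult_in_carrier smult_smult of_int_sgn_int M.a_assoc)
qed

end

text \<open>Homogeneous arguments are the values of four letters, so each side of the identity is
  the value of a combination of words, and the difference cancels already among the words.\<close>

lemma tortkara_commutator_algebra: "tortkara (commutator_algebra A)"
proof (intro tortkara.intro tortkara_axioms.intro superalgebra_commutator_algebra)
  let ?C = "commutator_algebra A"
  interpret C: superalgebra ?C by (rule superalgebra_commutator_algebra)
  fix a b i j
  assume "a \<in> homog ?C i" "b \<in> homog ?C j"
  then have ab: "a \<in> homog A i" "b \<in> homog A j" by (simp_all add: commutator_algebra_def)
  then have c: "a \<in> carrier A" "b \<in> carrier A" by (simp_all add: homog_carrier)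
  define s :: 'b where "s = sgn2 (i * j)"
  have s: "s * s = 1" "sgn2 (j * i) = s" by (simp_all add: s_def sgn2_def mult.commute)
  have "supercommutator A a b = (-1) \<odot> (s \<odot> supercommutator A b a)"
    unfolding supercommutator_homog[OF ab] supercommutator_homog[OF ab(2,1)] s s_def[symmetric]
    using c by (simp add: arith s smult_1)
  then show "a \<otimes>\<^bsub>?C\<^esub> b = \<ominus>\<^bsub>?C\<^esub> (sgn2 (i * j) \<odot>\<^bsub>?C\<^esub> (b \<otimes>\<^bsub>?C\<^esub> a))"
    using C.minus_one[of "s \<odot> supercommutator A b a"] c supercommutator_closed
    by (simp add: commutator_algebra_def s_def smult_in_carrier)
next
  let ?C = "commutator_algebra A"
  fix a b c d i j k l
  assume abcd: "a \<in> homog ?C i" "b \<in> homog ?C j" "c \<in> homog ?C k" "d \<in> homog ?C l"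
  \<comment> \<open>The parity list leaves letters beyond 3 with an unspecified parity. Zero is
    homogeneous of every parity, so the assumption on \<open>v\<close> holds for all
    letters.\<close>
  define v where "v n = (if n < 4 then [a, b, c, d] ! n else \<zero>)" for n
  define par where "par = (!) [i, j, k, l]"
  have "n < 4 \<Longrightarrow> n = 0 \<or> n = 1 \<or> n = 2 \<or> n = 3" for n :: nat by linarith
  then have v: "v n \<in> homog A (par n)" for n
    using abcd zero_homog by (cases "n < 4") (force simp: v_def par_def commutator_algebra_def)+
  note br = words_eval_bracket[OF v] words_homog_bracket
  note jac = words_eval_jacobian[OF v] words_homog_jacobian
  have letters: "words_eval v [([0], 1)] = a" "words_eval v [([1], 1)] = b"
      "words_eval v [([2], 1)] = c" "words_eval v [([3], 1)] = d"
    unfolding words_eval_letter[OF v] by (simp_all add: v_def)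
  let ?a = "[([0 :: nat], 1)]" and ?b = "[([1 :: nat], 1)]" and ?c = "[([2 :: nat], 1)]" and ?d = "[([3 :: nat], 1)]"
  let ?E = "words_eval v" and ?br = "words_bracket par"
  have h: "words_homog par i ?a" "words_homog par j ?b" "words_homog par k ?c" "words_homog par l ?d"
    by (simp_all add: words_homog_def word_parity_def par_def)
  define p q r t where
    "p = ?br ((i + j) * (k + l)) (?br (i * j) ?a ?b) (?br (k * l) ?c ?d)" and
    "q = ?br ((i + l) * (j + k)) (?br (i * l) ?a ?d) (?br (j * k) ?b ?c)" and
    "r = ?br ((i + j + k) * l) (words_jacobian par i j k ?a ?b ?c) ?d" and
    "t = ?br (j * (i + k + l)) ?b (words_jacobian par i k l ?a ?c ?d)"
  have C_simps: "x \<otimes>\<^bsub>?C\<^esub> y = supercommutator A x y" "x \<oplus>\<^bsub>?C\<^esub> y = x \<oplus> y" "e \<odot>\<^bsub>?C\<^esub> x = e \<odot> x" for x y e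
    by (simp_all add: commutator_algebra_def)
  have p: "supercommutator A (supercommutator A a b) (supercommutator A c d) = ?E p"
    unfolding letters[symmetric] br(1)[OF h(1,2)] br(1)[OF h(3,4)] p_def
    by (rule br(1)[OF br(2)[OF h(1,2)] br(2)[OF h(3,4)]])
  have q: "supercommutator A (supercommutator A a d) (supercommutator A b c) = ?E q"
    unfolding letters[symmetric] br(1)[OF h(1,4)] br(1)[OF h(2,3)] q_def
    by (rule br(1)[OF br(2)[OF h(1,4)] br(2)[OF h(2,3)]])
  have r: "supercommutator A (super_jacobian ?C j k a b c) d = ?E r"
    unfolding letters[symmetric] jac(1)[OF h(1-3)] r_def
    by (rule br(1)[OF jac(2)[OF h(1-3)] h(4)])
  have t: "supercommutator A b (super_jacobian ?C k l a c d) = ?E t"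
    unfolding letters[symmetric] jac(1)[OF h(1,3,4)] t_def
    by (rule br(1)[OF h(2) jac(2)[OF h(1,3,4)]])
  define s s' :: 'b where "s = sgn2 (l * (j + k))" and "s' = sgn2 (i * j)"
  have "words_tortkara i j k l = p @ scale_words (- sgn_int (l * (j + k))) q @
      scale_words (-1) r @ scale_words (- sgn_int (i * j)) t"
    by (simp only: words_tortkara_def Let_def p_def q_def r_def t_def par_def)
  then have "?E p \<oplus> ((- s) \<odot> ?E q \<oplus> ((-1) \<odot> ?E r \<oplus> (- s') \<odot> ?E t)) = ?E (words_tortkara i j k l)"
    by (simp only: words_eval_append[OF v] words_eval_scale[OF v] of_int_minus of_int_sgn_int of_int_1 s_def s'_def)
  also have "\<dots> = \<zero>"
    by (rule words_eval_vanish[OF v words_vanish_tortkara])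
  finally have zero: "?E p \<oplus> ((- s) \<odot> ?E q \<oplus> ((-1) \<odot> ?E r \<oplus> (- s') \<odot> ?E t)) = \<zero>" .
  have diff: "(P \<ominus> s \<odot> Q) \<ominus> (R \<oplus> s' \<odot> T) = P \<oplus> ((- s) \<odot> Q \<oplus> ((-1) \<odot> R \<oplus> (- s') \<odot> T))"
    if "P \<in> carrier A" "Q \<in> carrier A" "R \<in> carrier A" "T \<in> carrier A" for P Q R T
    using that by (simp add: minus_eq_smult smult_in_carrier smult_distrib_left smult_smult M.a_assoc)
  note E = words_eval_closed[OF v]
  have "?E p \<ominus> s \<odot> ?E q = ?E r \<oplus> s' \<odot> ?E t"
    by (rule eq_if_minus_eq_zero[OF _ _ trans[OF diff[OF E E E E] zero]])
      (intro M.minus_closed M.a_closed smult_in_carrier E)+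
  then show "(a \<otimes>\<^bsub>?C\<^esub> b) \<otimes>\<^bsub>?C\<^esub> (c \<otimes>\<^bsub>?C\<^esub> d) \<ominus>\<^bsub>?C\<^esub>
        sgn2 (l * (j + k)) \<odot>\<^bsub>?C\<^esub> ((a \<otimes>\<^bsub>?C\<^esub> d) \<otimes>\<^bsub>?C\<^esub> (b \<otimes>\<^bsub>?C\<^esub> c))
      = super_jacobian ?C j k a b c \<otimes>\<^bsub>?C\<^esub> d
        \<oplus>\<^bsub>?C\<^esub> sgn2 (i * j) \<odot>\<^bsub>?C\<^esub> (b \<otimes>\<^bsub>?C\<^esub> super_jacobian ?C k l a c d)"
    unfolding minus_commutator_algebra s_def s'_def
      C_simps p q r t .
qed

end

section \<open>The obstruction to being special\<close>

definition words_x_xy :: "(xy list \<times> int) list" where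
  "words_x_xy = words_bracket xy_parity 1 [([GX], 1)]
     (words_bracket xy_parity 0 [([GX], 1)] [([GY], 1)])"

definition words_xx_x :: "(xy list \<times> int) list" where
  "words_xx_x = words_bracket xy_parity 0
     (words_bracket xy_parity 1 [([GX], 1)] [([GX], 1)]) [([GX], 1)]"

definition words_xx_y_x :: "(xy list \<times> int) list" where
  "words_xx_y_x = words_bracket xy_parity 0
     (words_bracket xy_parity 0
       (words_bracket xy_parity 1 [([GX], 1)] [([GX], 1)]) [([GY], 1)]) [([GX], 1)]"

text \<open>With b = [x,[x,y]] = -2 yxx and c = [[x,x],x] = 2 xxx, the identity is [[[x,x],y],x] =
  yc + 2 bx + 2 xb - cy. It follows from bx = -2 yxxx, xb = -2 xyxx, cy = 2 xxxy and yc = 2 (yxxx +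
  xyxx + xxyx). The products on the right are Zinbiel products, not brackets.\<close>

lemma words_vanish_xx_y_x:
  "words_vanish (words_xx_y_x @
     scale_words (-1) (words_mult xy_parity [([GY], 1)] words_xx_x) @
     scale_words (-2) (words_mult xy_parity words_x_xy [([GX], 1)]) @
     scale_words (-2) (words_mult xy_parity [([GX], 1)] words_x_xy) @
     words_mult xy_parity words_xx_x [([GY], 1)])"
  by code_simp

text \<open>Hypotheses and conclusion mention only brackets, but the argument passes through the
  product of A. This is the property of special superalgebras that the quotient constructed below
  violates.\<close>

lemma (in zinbiel) supercommutator_xx_y_x_eq_zero:
  assumes x: "x \<in> homog A 1" and y: "y \<in> homog A 0"
    and xxy: "supercommutator A x (supercommutator A x y) = \<zero>"
    and xxx: "supercommutator A (supercommutator A x x) x = \<zero>"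
  shows "supercommutator A (supercommutator A (supercommutator A x x) y) x = \<zero>"
proof -
  define v where "v n = (case n of GX \<Rightarrow> x | GY \<Rightarrow> y)" for n
  let ?par = xy_parity and ?E = "words_eval v"
  have v: "v n \<in> homog A (?par n)" for n
    using x y by (cases n) (simp_all add: v_def)
  let ?x = "[([GX], 1)]" and ?y = "[([GY], 1)]"
  have letters: "?E ?x = x" "?E ?y = y"
    unfolding words_eval_letter[OF v] by (simp_all add: v_def)
  have h: "words_homog ?par 1 ?x" "words_homog ?par 0 ?y"
    by (simp_all add: words_homog_def word_parity_def)
  note br = words_eval_bracket[OF v] and hbr = words_homog_bracket
  have h1: "words_homog ?par 1 (words_bracket ?par p ?x ?y)" "words_homog ?par 0 (words_bracket ?par p ?x ?x)" for p
    using hbr[OF h, of p] hbr[OF h(1,1), of p] by simp_all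
  have h2: "words_homog ?par 0 words_x_xy" "words_homog ?par 1 words_xx_x"
    "words_homog ?par 0 (words_bracket ?par p (words_bracket ?par q ?x ?x) ?y)" for p q
    using hbr[OF h(1) h1(1)] hbr[OF h1(2) h(1)] hbr[OF h1(2) h(2)]
    by (simp_all add: words_x_xy_def words_xx_x_def)
  have e: "?E words_x_xy = \<zero>" "?E words_xx_x = \<zero>"
    using br[OF h] br[OF h(1) h1(1)] br[OF h(1,1)] br[OF h1(2) h(1)] xxy xxx
    by (simp_all add: words_x_xy_def words_xx_x_def letters)
  note m = words_eval_mult[OF v]
  have "?E (words_mult ?par ?y words_xx_x) = \<zero>" "?E (words_mult ?par words_x_xy ?x) = \<zero>"
    "?E (words_mult ?par ?x words_x_xy) = \<zero>" "?E (words_mult ?par words_xx_x ?y) = \<zero>"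
    using m[OF h(2) h2(2)] m[OF h2(1) h(1)] m[OF h(1) h2(1)] m[OF h2(2) h(2)] x y homog_carrier
    by (simp_all add: e letters prod_zero)
  moreover have "c \<odot> \<zero> = \<zero>" for c :: 'b using smult_r_null[of c] by simp
  ultimately have "?E words_xx_y_x = \<zero>"
    using words_eval_vanish[of v xy_parity, OF v words_vanish_xx_y_x]
    by (simp add: words_eval_append[OF v] words_eval_scale[OF v] words_eval_closed[OF v])
  then show ?thesis
    using br[OF h(1,1)] br[OF h1(2) h(2)] br[OF h2(3) h(1)]
    by (simp add: words_xx_y_x_def letters)
qed

section \<open>Free superalgebras\<close>

text \<open>Cancellation can make the support of a sum smaller than the union of the supports. All
  three sums are therefore taken over that union, where additivity of \<open>h\<close> makes the
  extra terms vanish.\<close>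

lemma sum_keys_add:
  fixes h :: "'s \<Rightarrow> 'k::ab_group_add \<Rightarrow> 'c::ab_group_add"
  assumes "\<And>s a b. h s (a + b) = h s a + h s b"
  shows "(\<Sum>s\<in>Poly_Mapping.keys (p + q). h s (Poly_Mapping.lookup (p + q) s)) =
    (\<Sum>s\<in>Poly_Mapping.keys p. h s (Poly_Mapping.lookup p s)) +
    (\<Sum>s\<in>Poly_Mapping.keys q. h s (Poly_Mapping.lookup q s))"
proof -
  let ?K = "Poly_Mapping.keys p \<union> Poly_Mapping.keys q"
  have z: "h s 0 = 0" for s using assms[of s 0 0] by simp
  have K: "(\<Sum>s\<in>Poly_Mapping.keys r. h s (Poly_Mapping.lookup r s)) = (\<Sum>s\<in>?K. h s (Poly_Mapping.lookup r s))"
    if "Poly_Mapping.keys r \<subseteq> ?K" for r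
    using that by (intro sum.mono_neutral_left) (auto simp: in_keys_iff z)
  show ?thesis
    unfolding K[OF Poly_Mapping.keys_add] K[OF Un_upper1] K[OF Un_upper2]
    by (simp add: lookup_add assms sum.distrib)
qed

lemma lookup_scale: "Poly_Mapping.lookup (Poly_Mapping.map ((*) (r::'k::field)) p) s = r * Poly_Mapping.lookup p s"
  by (simp add: Poly_Mapping.map.rep_eq when_def)

lemma sum_keys_scale:
  fixes h :: "'s \<Rightarrow> 'k::field \<Rightarrow> 'c::comm_monoid_add"
  assumes "\<And>s. h s 0 = 0"
  shows "(\<Sum>s\<in>Poly_Mapping.keys (Poly_Mapping.map ((*) r) p). h s (Poly_Mapping.lookup (Poly_Mapping.map ((*) r) p) s)) =
    (\<Sum>s\<in>Poly_Mapping.keys p. h s (r * Poly_Mapping.lookup p s))"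
  unfolding lookup_scale by (rule sum.mono_neutral_left) (auto simp: in_keys_iff lookup_scale assms)

lemma free_superalgebra_simps:
  "carrier (free_superalgebra par) = UNIV"
  "\<zero>\<^bsub>free_superalgebra par\<^esub> = 0"
  "p \<oplus>\<^bsub>free_superalgebra par\<^esub> q = p + q"
  "r \<odot>\<^bsub>free_superalgebra par\<^esub> p = Poly_Mapping.map ((*) r) p"
  "p \<otimes>\<^bsub>free_superalgebra par\<^esub> q = (\<Sum>s\<in>Poly_Mapping.keys p. \<Sum>t\<in>Poly_Mapping.keys q.
        Poly_Mapping.single (Prod s t) (Poly_Mapping.lookup p s * Poly_Mapping.lookup q t))"
  "homog (free_superalgebra par) i = {p. \<forall>s\<in>Poly_Mapping.keys p. monomial_parity par s = i}"
  by (simp_all add: free_superalgebra_def)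

lemma superalgebra_free_superalgebra:
  "superalgebra (free_superalgebra par :: ('k::field_char_0, 'x monomial \<Rightarrow>\<^sub>0 'k) superalgebra)"
proof (rule superalgebraI)
  let ?F = "free_superalgebra par :: ('k, 'x monomial \<Rightarrow>\<^sub>0 'k) superalgebra"
  have homog_sum: "sum f S \<in> homog ?F i" if "\<And>x. x \<in> S \<Longrightarrow> f x \<in> homog ?F i" for f :: "'y \<Rightarrow> _" and S i
    using that
  proof (induction S rule: infinite_finite_induct)
    case (insert x S)
    then have "f x \<in> homog ?F i" "sum f S \<in> homog ?F i" by simp_all
    then show ?case using insert(1,2) Poly_Mapping.keys_add[of "f x" "sum f S"]
      by (auto simp: free_superalgebra_simps)
  qed (auto simp: free_superalgebra_simps)
  show "abelian_group ?F"
    by (rule abelian_groupI) (auto simp: free_superalgebra_simps add_ac intro: exI[of _ "- _"])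
  show "\<exists>b\<in>homog ?F 0. \<exists>c\<in>homog ?F 1. a = b \<oplus>\<^bsub>?F\<^esub> c" for a
  proof (intro bexI)
    let ?s = "\<lambda>i. \<Sum>s\<in>{s\<in>Poly_Mapping.keys a. monomial_parity par s = i}. Poly_Mapping.single s (Poly_Mapping.lookup a s)"
    have "(\<Sum>s\<in>Poly_Mapping.keys a. Poly_Mapping.single s (Poly_Mapping.lookup a s)) = ?s 0 + ?s 1"
      by (subst sum.union_disjoint[symmetric]) (auto intro!: sum.cong)
    moreover have "(\<Sum>s\<in>Poly_Mapping.keys a. Poly_Mapping.single s (Poly_Mapping.lookup a s)) = a"
      by (rule poly_mapping_eqI) (simp add: lookup_sum lookup_single when_def in_keys_iff)
    ultimately show "a = ?s 0 \<oplus>\<^bsub>?F\<^esub> ?s 1" by (simp add: free_superalgebra_simps)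
    have "?s i \<in> homog ?F i" for i
      by (intro homog_sum) (auto simp: free_superalgebra_simps)
    from this[of 0] this[of 1] show "?s 0 \<in> homog ?F 0" "?s 1 \<in> homog ?F 1" by simp_all
  qed
  show "a \<otimes>\<^bsub>?F\<^esub> b \<in> homog ?F (i + j)" if ab: "a \<in> homog ?F i" "b \<in> homog ?F j" for a b i j
    unfolding free_superalgebra_simps(5)
  proof (intro homog_sum)
    fix s t assume st: "s \<in> Poly_Mapping.keys a" "t \<in> Poly_Mapping.keys b"
    then have "monomial_parity par s = i" "monomial_parity par t = j"
      using ab by (auto simp: free_superalgebra_simps)
    then have "monomial_parity par (Prod s t) = i + j" by (simp only: monomial_parity.simps)
    then show "Poly_Mapping.single (Prod s t) (Poly_Mapping.lookup a s * Poly_Mapping.lookup b t) \<in> homog ?F (i + j)"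
      by (simp only: free_superalgebra_simps keys_single) auto
  qed
  show "(a \<oplus>\<^bsub>?F\<^esub> b) \<otimes>\<^bsub>?F\<^esub> c = a \<otimes>\<^bsub>?F\<^esub> c \<oplus>\<^bsub>?F\<^esub> b \<otimes>\<^bsub>?F\<^esub> c" for a b c
    unfolding free_superalgebra_simps
    by (rule sum_keys_add) (simp add: distrib_right single_add sum.distrib)
  show "c \<otimes>\<^bsub>?F\<^esub> (a \<oplus>\<^bsub>?F\<^esub> b) = c \<otimes>\<^bsub>?F\<^esub> a \<oplus>\<^bsub>?F\<^esub> c \<otimes>\<^bsub>?F\<^esub> b" for a b c
    unfolding free_superalgebra_simps sum.distrib[symmetric]
    by (intro sum.cong sum_keys_add refl) (simp add: distrib_left single_add)
  have scale_sum: "Poly_Mapping.map ((*) r) (sum f S) = (\<Sum>x\<in>S. Poly_Mapping.map ((*) r) (f x))"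
    for r and f :: "'y \<Rightarrow> 'x monomial \<Rightarrow>\<^sub>0 'k" and S
    by (rule poly_mapping_eqI) (simp add: lookup_scale lookup_sum sum_distrib_left)
  have scale_single: "Poly_Mapping.map ((*) r) (Poly_Mapping.single s c) = Poly_Mapping.single s (r * c)"
    for r c :: 'k and s :: "'x monomial"
    by (rule poly_mapping_eqI) (simp add: lookup_scale lookup_single when_def)
  show "(r \<odot>\<^bsub>?F\<^esub> a) \<otimes>\<^bsub>?F\<^esub> b = r \<odot>\<^bsub>?F\<^esub> (a \<otimes>\<^bsub>?F\<^esub> b)" for r a b
    unfolding free_superalgebra_simps scale_sum scale_single
    by (subst sum_keys_scale) (simp_all add: mult.assoc)
  show "a \<otimes>\<^bsub>?F\<^esub> (r \<odot>\<^bsub>?F\<^esub> b) = r \<odot>\<^bsub>?F\<^esub> (a \<otimes>\<^bsub>?F\<^esub> b)" for r a b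
    unfolding free_superalgebra_simps scale_sum scale_single
    by (subst sum_keys_scale) (simp_all add: mult_ac)
qed (auto simp: free_superalgebra_simps lookup_scale lookup_add algebra_simps in_keys_iff
    intro!: poly_mapping_eqI dest: Poly_Mapping.keys_add[THEN subsetD])

lemma zinbiel_ideal_graded:
  "graded_ideal (free_superalgebra par :: ('k::field_char_0, 'x monomial \<Rightarrow>\<^sub>0 'k) superalgebra) (zinbiel_ideal par)"
  unfolding zinbiel_ideal_def
  by (rule superalgebra.graded_ideal_hull[OF superalgebra_free_superalgebra])
    (simp add: free_superalgebra_simps)

lemma zinbiel_free_zinbiel: "zinbiel (free_zinbiel par :: ('k::field_char_0, ('x monomial \<Rightarrow>\<^sub>0 'k) set) superalgebra)"
  unfolding free_zinbiel_def
  by (rule superalgebra.zinbiel_quotient[OF superalgebra_free_superalgebra zinbiel_ideal_graded])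
    (unfold zinbiel_ideal_def, rule hull_subset)

lemma zinbiel_gen_homog: "zinbiel_gen par x \<in> homog (free_zinbiel par :: ('k::field_char_0, ('x monomial \<Rightarrow>\<^sub>0 'k) set) superalgebra) (par x)"
  unfolding free_zinbiel_def zinbiel_gen_def
    superalgebra.homog_quotient[OF superalgebra_free_superalgebra zinbiel_ideal_graded]
  by (rule imageI) (simp add: free_superalgebra_simps)

text \<open>Since B satisfies the Zinbiel identity and h preserves parities, h kills all relations.
  Its kernel is a graded ideal, so it contains the ideal they generate, and h factors.\<close>

lemma free_zinbiel_hom:
  fixes B :: "('k::field_char_0, 'b) superalgebra"
  assumes "zinbiel B" "h \<in> superalgebra_hom (free_superalgebra par) B"
  obtains k where "k \<in> superalgebra_hom (free_zinbiel par) B"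
    "\<And>x. k (zinbiel_gen par x) = h (Poly_Mapping.single (Gen x) 1)"
proof -
  let ?F = "free_superalgebra par :: ('k, 'a monomial \<Rightarrow>\<^sub>0 'k) superalgebra"
  interpret F: superalgebra ?F by (rule superalgebra_free_superalgebra)
  interpret B: zinbiel B by fact
  note h = superalgebra_homD[OF assms(2)]
  have "graded_ideal B {\<zero>\<^bsub>B\<^esub>}"
    using B.smult_r_null B.homog_part_homog[OF B.zero_homog]
    by (auto simp: B.graded_ideal_iff B.prod_zero)
  then have ker: "graded_ideal ?F {a \<in> carrier ?F. h a \<in> {\<zero>\<^bsub>B\<^esub>}}"
    by (rule graded_ideal_preimage[OF F.superalgebra_axioms B.superalgebra_axioms assms(2)])
  have "zinbiel_relations ?F \<subseteq> {a \<in> carrier ?F. h a \<in> {\<zero>\<^bsub>B\<^esub>}}"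
  proof
    fix r assume "r \<in> zinbiel_relations ?F"
    then obtain a b c i j k where abc: "a \<in> homog ?F i" "b \<in> homog ?F j" "c \<in> homog ?F k" and
      r: "r = a \<otimes>\<^bsub>?F\<^esub> (b \<otimes>\<^bsub>?F\<^esub> c) \<ominus>\<^bsub>?F\<^esub>
        (a \<otimes>\<^bsub>?F\<^esub> b \<otimes>\<^bsub>?F\<^esub> c \<oplus>\<^bsub>?F\<^esub> sgn2 (i * j) \<odot>\<^bsub>?F\<^esub> (b \<otimes>\<^bsub>?F\<^esub> a \<otimes>\<^bsub>?F\<^esub> c))"
      unfolding zinbiel_relations_def by blast
    note closed = abc[THEN F.homog_carrier] F.prod_closed F.smult_in_carrier F.M.a_closed
    have "h r = h a \<otimes>\<^bsub>B\<^esub> (h b \<otimes>\<^bsub>B\<^esub> h c) \<ominus>\<^bsub>B\<^esub>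
        (h a \<otimes>\<^bsub>B\<^esub> h b \<otimes>\<^bsub>B\<^esub> h c \<oplus>\<^bsub>B\<^esub> sgn2 (i * j) \<odot>\<^bsub>B\<^esub> (h b \<otimes>\<^bsub>B\<^esub> h a \<otimes>\<^bsub>B\<^esub> h c))"
      unfolding r
      by (simp only: h(2-4) closed superalgebra_hom_minus[OF F.superalgebra_axioms B.superalgebra_axioms assms(2)])
    also have "\<dots> = \<zero>\<^bsub>B\<^esub>"
      unfolding B.zinbiel_identity[OF abc[THEN h(5)], symmetric] a_minus_def
      by (intro B.M.r_neg B.prod_closed h(1) closed)
    finally show "r \<in> {a \<in> carrier ?F. h a \<in> {\<zero>\<^bsub>B\<^esub>}}"
      by (simp add: free_superalgebra_simps)
  qed
  then have "zinbiel_ideal par \<subseteq> {a \<in> carrier ?F. h a \<in> {\<zero>\<^bsub>B\<^esub>}}"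
    unfolding zinbiel_ideal_def using ker by (rule hull_minimal)
  then have "h a = \<zero>\<^bsub>B\<^esub>" if "a \<in> zinbiel_ideal par" for a using that by blast
  then show ?thesis
    using F.hom_factors_through_quotient[OF zinbiel_ideal_graded B.superalgebra_axioms assms(2)] that
    by (metis UNIV_I free_superalgebra_simps(1) free_zinbiel_def zinbiel_gen_def)
qed

lemma sub_superalgebra_gens:
  "sub_superalgebra (commutator_algebra (free_zinbiel par))
    (sub_superalgebra (commutator_algebra (free_zinbiel par)) hull range (zinbiel_gen par ::
      'x \<Rightarrow> ('x monomial \<Rightarrow>\<^sub>0 'k::field_char_0) set))"
proof -
  interpret Z: zinbiel "free_zinbiel par :: ('k::field_char_0, ('x monomial \<Rightarrow>\<^sub>0 'k) set) superalgebra"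
    by (rule zinbiel_free_zinbiel)
  interpret C: superalgebra "commutator_algebra (free_zinbiel par :: ('k::field_char_0, ('x monomial \<Rightarrow>\<^sub>0 'k) set) superalgebra)"
    by (rule Z.superalgebra_commutator_algebra)
  show ?thesis
    using zinbiel_gen_homog[THEN Z.homog_carrier]
    by (intro C.sub_superalgebra_hull) (auto simp: commutator_algebra_def)
qed

lemma tortkara_free_special_tortkara:
  "tortkara (free_special_tortkara par :: ('k::field_char_0, ('x monomial \<Rightarrow>\<^sub>0 'k) set) superalgebra)"
  unfolding free_special_tortkara_def Let_def
  by (intro tortkara_restrict sub_superalgebra_gens zinbiel.tortkara_commutator_algebra zinbiel_free_zinbiel)

section \<open>A Zinbiel superalgebra of dimension eight\<close>

text \<open>
  The quotient of the free Zinbiel superalgebra in which the words of degree above three in \<open>x\<close> or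
  above one in \<open>y\<close> vanish, \<open>xyxx = yxxx\<close> is the basis element \<open>Vtop\<close>, \<open>xxx = 0\<close> and
  \<open>xxy = -xyx - yxx\<close>.
\<close>

datatype zin8 = Vx | Vy | Vxx | Vxy | Vyx | Vxyx | Vyxx | Vtop

primrec zin8_parity :: "zin8 \<Rightarrow> bit" where
  "zin8_parity Vx = 1" | "zin8_parity Vy = 0" | "zin8_parity Vxx = 0" | "zin8_parity Vxy = 1"
| "zin8_parity Vyx = 1" | "zin8_parity Vxyx = 0" | "zin8_parity Vyxx = 0" | "zin8_parity Vtop = 1"

text \<open>Coordinates of the half-shuffle products reduced by the relations: x(yx) = y(xx) = xyx +
  yxx and (xx)y = -xyx - yxx in degree three. In degree four, x(xyx) = -xyxx, x(yxx) = xyxx,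
  (xy)(xx) = xyxx and (yx)(xx) = -xyxx, while (xx)(yx) = xxyx + xyxx + yxxx = 0.\<close>

definition zin8_mult :: "(zin8 \<Rightarrow> 'k::field_char_0) \<Rightarrow> (zin8 \<Rightarrow> 'k) \<Rightarrow> zin8 \<Rightarrow> 'k" where
  "zin8_mult a b w = (case w of
     Vx \<Rightarrow> 0 | Vy \<Rightarrow> 0
   | Vxx \<Rightarrow> a Vx * b Vx | Vxy \<Rightarrow> a Vx * b Vy | Vyx \<Rightarrow> a Vy * b Vx
   | Vxyx \<Rightarrow> a Vxy * b Vx + a Vx * b Vyx + a Vy * b Vxx - a Vxx * b Vy
   | Vyxx \<Rightarrow> a Vyx * b Vx + a Vx * b Vyx + a Vy * b Vxx - a Vxx * b Vy
   | Vtop \<Rightarrow> a Vxyx * b Vx + a Vyxx * b Vx - a Vx * b Vxyx + a Vx * b Vyxx + a Vxy * b Vxx - a Vyx * b Vxx)"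

definition zin8 :: "('k::field_char_0, zin8 \<Rightarrow> 'k) superalgebra" where
  "zin8 = \<lparr>carrier = UNIV, monoid.mult = zin8_mult, one = undefined, ring.zero = (\<lambda>_. 0),
     add = (\<lambda>a b w. a w + b w), module.smult = (\<lambda>r a w. r * a w),
     homog = (\<lambda>i. {a. \<forall>w. zin8_parity w \<noteq> i \<longrightarrow> a w = 0})\<rparr>"

lemma zin8_simps:
  "carrier zin8 = UNIV" "\<zero>\<^bsub>zin8\<^esub> = (\<lambda>_. 0)" "a \<oplus>\<^bsub>zin8\<^esub> b = (\<lambda>w. a w + b w)"
  "r \<odot>\<^bsub>zin8\<^esub> a = (\<lambda>w. r * a w)" "a \<otimes>\<^bsub>zin8\<^esub> b = zin8_mult a b"
  "a \<in> homog zin8 i \<longleftrightarrow> (\<forall>w. zin8_parity w \<noteq> i \<longrightarrow> a w = 0)"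
  by (simp_all add: zin8_def)

lemma all_zin8: "(\<forall>w. P w) \<longleftrightarrow> P Vx \<and> P Vy \<and> P Vxx \<and> P Vxy \<and> P Vyx \<and> P Vxyx \<and> P Vyxx \<and> P Vtop"
  by (metis zin8.exhaust)

lemma superalgebra_zin8: "superalgebra (zin8 :: ('k::field_char_0, _) superalgebra)"
proof (rule superalgebraI)
  show "abelian_group (zin8 :: ('k, _) superalgebra)"
    by (rule abelian_groupI) (auto simp: zin8_simps fun_eq_iff intro: exI[of _ "\<lambda>w. - _ w"])
  fix a :: "zin8 \<Rightarrow> 'k"
  show "a = \<zero>\<^bsub>zin8\<^esub>" if "a \<in> homog zin8 0" "a \<in> homog zin8 1"
  proof
    show "a w = \<zero>\<^bsub>zin8\<^esub> w" for w using that by (cases "zin8_parity w") (auto simp: zin8_simps)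
  qed
  show "\<exists>b\<in>homog zin8 0. \<exists>c\<in>homog zin8 1. a = b \<oplus>\<^bsub>zin8\<^esub> c"
    by (intro bexI[of _ "\<lambda>w. if zin8_parity w = 0 then a w else 0"]
        bexI[of _ "\<lambda>w. if zin8_parity w = 1 then a w else 0"]) (auto simp: zin8_simps fun_eq_iff)
  show "a \<otimes>\<^bsub>zin8\<^esub> b \<in> homog zin8 (i + j)" if "a \<in> homog zin8 i" "b \<in> homog zin8 j" for b i j
    using that by (cases i; cases j) (auto simp: zin8_simps all_zin8 zin8_mult_def)
qed (auto simp: zin8_simps zin8_mult_def fun_eq_iff algebra_simps split: zin8.split)

lemma zinbiel_zin8: "zinbiel (zin8 :: ('k::field_char_0, _) superalgebra)"
proof (intro zinbiel.intro zinbiel_axioms.intro superalgebra_zin8)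
  fix a b c :: "zin8 \<Rightarrow> 'k" and i j k
  assume "a \<in> homog zin8 i" "b \<in> homog zin8 j" "c \<in> homog zin8 k"
  then show "a \<otimes>\<^bsub>zin8\<^esub> (b \<otimes>\<^bsub>zin8\<^esub> c) =
      a \<otimes>\<^bsub>zin8\<^esub> b \<otimes>\<^bsub>zin8\<^esub> c \<oplus>\<^bsub>zin8\<^esub> sgn2 (i * j) \<odot>\<^bsub>zin8\<^esub> (b \<otimes>\<^bsub>zin8\<^esub> a \<otimes>\<^bsub>zin8\<^esub> c)"
    by (cases i; cases j; cases k) (simp_all add: zin8_simps zin8_mult_def fun_eq_iff all_zin8 sgn2_def algebra_simps)
qed

section \<open>The evaluation homomorphism into the eight-dimensional superalgebra\<close>

primrec zin8_monomial :: "xy monomial \<Rightarrow> zin8 \<Rightarrow> 'k::field_char_0" where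
  "zin8_monomial (Gen z) = (\<lambda>w. if w = (case z of GX \<Rightarrow> Vx | GY \<Rightarrow> Vy) then 1 else 0)"
| "zin8_monomial (Prod s t) = zin8_mult (zin8_monomial s) (zin8_monomial t)"

definition zin8_eval :: "(xy monomial \<Rightarrow>\<^sub>0 'k) \<Rightarrow> zin8 \<Rightarrow> 'k::field_char_0" where
  "zin8_eval p w = (\<Sum>s\<in>Poly_Mapping.keys p. Poly_Mapping.lookup p s * zin8_monomial s w)"

lemma zin8_monomial_homog:
  "(zin8_monomial s :: zin8 \<Rightarrow> 'k::field_char_0) \<in> homog zin8 (monomial_parity xy_parity s)"
proof (induction s)
  case (Gen z)
  then show ?case by (cases z) (simp_all add: zin8_simps)
next
  case (Prod s t)
  then show ?case
    using superalgebra.prod_homog[OF superalgebra_zin8 Prod] by (simp only: zin8_simps zin8_monomial.simps monomial_parity.simps)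
qed

lemma zin8_eval_add: "zin8_eval (p + q) w = zin8_eval p w + zin8_eval q w"
  unfolding zin8_eval_def by (rule sum_keys_add) (simp add: distrib_right)

lemma zin8_eval_sum: "zin8_eval (sum f S) w = (\<Sum>x\<in>S. zin8_eval (f x) w)"
proof (induction S rule: infinite_finite_induct)
  case (insert x S)
  then show ?case by (simp add: zin8_eval_add)
qed (simp_all add: zin8_eval_def)

lemma zin8_eval_single: "zin8_eval (Poly_Mapping.single s c) w = c * zin8_monomial s w"
  by (simp add: zin8_eval_def)

lemma zin8_eval_hom: "zin8_eval \<in> superalgebra_hom (free_superalgebra xy_parity) (zin8 :: ('k::field_char_0, _) superalgebra)"
proof -
  have "zin8_eval (\<Sum>s\<in>Poly_Mapping.keys p. \<Sum>t\<in>Poly_Mapping.keys q.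
        Poly_Mapping.single (Prod s t) (Poly_Mapping.lookup p s * Poly_Mapping.lookup q t)) =
      zin8_mult (zin8_eval p) (zin8_eval q)" for p q :: "xy monomial \<Rightarrow>\<^sub>0 'k"
  proof
    fix w
    \<comment> \<open>Each coordinate of \<open>zin8_mult\<close> is a signed sum of products of one
      coordinate of either factor. As \<open>B\<close> respects sums, differences and zero, it is
      enough to know it on a single such product.\<close>
    define B where "B F = (\<Sum>s\<in>Poly_Mapping.keys p. \<Sum>t\<in>Poly_Mapping.keys q.
        Poly_Mapping.lookup p s * Poly_Mapping.lookup q t * F s t)" for F
    have B: "B (\<lambda>s t. F s t + G s t) = B F + B G" "B (\<lambda>s t. F s t - G s t) = B F - B G" "B (\<lambda>s t. 0) = 0"
      for F G by (simp_all add: B_def distrib_left right_diff_distrib sum.distrib sum_subtractf)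
    have prod: "B (\<lambda>s t. zin8_monomial s u * zin8_monomial t v) = zin8_eval p u * zin8_eval q v" for u v
      unfolding B_def zin8_eval_def sum_product by (intro sum.cong refl) (simp add: mult_ac)
    have "zin8_eval (\<Sum>s\<in>Poly_Mapping.keys p. \<Sum>t\<in>Poly_Mapping.keys q.
        Poly_Mapping.single (Prod s t) (Poly_Mapping.lookup p s * Poly_Mapping.lookup q t)) w =
        B (\<lambda>s t. zin8_mult (zin8_monomial s) (zin8_monomial t) w)"
      by (simp add: zin8_eval_sum zin8_eval_single B_def)
    also have "\<dots> = zin8_mult (zin8_eval p) (zin8_eval q) w"
      by (cases w) (simp_all add: zin8_mult_def B prod)
    finally show "zin8_eval (\<Sum>s\<in>Poly_Mapping.keys p. \<Sum>t\<in>Poly_Mapping.keys q.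
        Poly_Mapping.single (Prod s t) (Poly_Mapping.lookup p s * Poly_Mapping.lookup q t)) w =
        zin8_mult (zin8_eval p) (zin8_eval q) w" .
  qed
  moreover have "zin8_eval (Poly_Mapping.map ((*) r) p) w = r * zin8_eval p w" for r and p :: "xy monomial \<Rightarrow>\<^sub>0 'k" and w
    unfolding zin8_eval_def by (subst sum_keys_scale) (simp_all add: sum_distrib_left mult.assoc)
  moreover have "zin8_eval p \<in> homog zin8 i" if "\<forall>s\<in>Poly_Mapping.keys p. monomial_parity xy_parity s = i"
    for p :: "xy monomial \<Rightarrow>\<^sub>0 'k" and i
    using that zin8_monomial_homog[where 'k='k] by (auto simp: zin8_simps zin8_eval_def intro!: sum.neutral)
  ultimately show ?thesis
    by (auto simp: superalgebra_hom_def free_superalgebra_simps zin8_simps(1-5) zin8_eval_add fun_eq_iff)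
qed

lemma homog_part_zin8: "homog_part zin8 i a = (\<lambda>w. if zin8_parity w = i then a w else 0)"
  by (rule superalgebra.homog_part_eqI[OF superalgebra_zin8, where d = "\<lambda>w. if zin8_parity w = i then 0 else a w"])
    (auto simp: zin8_simps fun_eq_iff)

lemma minus_zin8: "a \<ominus>\<^bsub>zin8\<^esub> b = (\<lambda>w. a w - b w)"
  by (simp add: superalgebra.minus_eq_smult[OF superalgebra_zin8] zin8_simps)

text \<open>The \<open>Vyxx\<close> coordinates of \<open>a\<close> and \<open>b\<close> do not
  occur on the right: the two contributions to \<open>Vtop\<close> cancel. Thus yxx has zero bracket
  with everything, which is why its span is an ideal for the bracket.\<close>

lemma supercommutator_zin8:
  "supercommutator zin8 a b w = (case w of
     Vx \<Rightarrow> 0 | Vy \<Rightarrow> 0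
   | Vxx \<Rightarrow> 2 * (a Vx * b Vx) | Vxy \<Rightarrow> a Vx * b Vy - b Vx * a Vy | Vyx \<Rightarrow> a Vy * b Vx - b Vy * a Vx
   | Vxyx \<Rightarrow> a Vxy * b Vx + b Vxy * a Vx + a Vx * b Vyx + b Vx * a Vyx + 2 * (a Vy * b Vxx) - 2 * (a Vxx * b Vy)
   | Vyxx \<Rightarrow> 2 * (a Vyx * b Vx) + 2 * (a Vx * b Vyx) + 2 * (a Vy * b Vxx) - 2 * (a Vxx * b Vy)
   | Vtop \<Rightarrow> 2 * (a Vxyx * b Vx) - 2 * (a Vx * b Vxyx) + a Vxy * b Vxx - b Vxy * a Vxx - a Vyx * b Vxx + b Vyx * a Vxx)"
  unfolding supercommutator_def Let_def homog_part_zin8 minus_zin8 zin8_simps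
  by (cases w) (simp_all add: zin8_mult_def sgn2_def algebra_simps)

definition zin8_ideal :: "(zin8 \<Rightarrow> 'k::field_char_0) set" where
  "zin8_ideal = {a. \<forall>w. w \<noteq> Vyxx \<longrightarrow> a w = 0}"

lemma graded_ideal_zin8_ideal: "graded_ideal (commutator_algebra zin8) (zin8_ideal :: (zin8 \<Rightarrow> 'k::field_char_0) set)"
proof -
  interpret M: superalgebra "zin8 :: ('k, _) superalgebra" by (rule superalgebra_zin8)
  interpret C: superalgebra "commutator_algebra (zin8 :: ('k, _) superalgebra)"
    by (rule M.superalgebra_commutator_algebra)
  \<comment> \<open>Homogeneous parts depend only on addition and grading, which the passage to the
    bracket leaves unchanged.\<close>
  have "homog_part (commutator_algebra zin8) i a = homog_part zin8 i a" for i and a :: "zin8 \<Rightarrow> 'k"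
    by (simp add: homog_part_def commutator_algebra_def)
  then show ?thesis
    unfolding C.graded_ideal_iff
    by (simp add: commutator_algebra_def zin8_simps zin8_ideal_def homog_part_zin8 all_zin8 supercommutator_zin8)
qed

section \<open>The exceptional quotient\<close>

theorem theorem5p5:
  shows "\<exists>I. graded_ideal
               (free_special_tortkara xy_parity ::
                  ('k::field_char_0, (xy monomial \<Rightarrow>\<^sub>0 'k) set) superalgebra) I \<and>
             exceptional (quotient_superalgebra (free_special_tortkara xy_parity) I)"
proof -
  let ?Z = "free_zinbiel xy_parity :: ('k, (xy monomial \<Rightarrow>\<^sub>0 'k) set) superalgebra"
  let ?ST = "free_special_tortkara xy_parity :: ('k, (xy monomial \<Rightarrow>\<^sub>0 'k) set) superalgebra"
  let ?M = "zin8 :: ('k, _) superalgebra"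
  let ?g = "zinbiel_gen xy_parity :: xy \<Rightarrow> (xy monomial \<Rightarrow>\<^sub>0 'k) set"
  interpret Z: zinbiel ?Z by (rule zinbiel_free_zinbiel)
  interpret M: zinbiel ?M by (rule zinbiel_zin8)
  interpret CZ: superalgebra "commutator_algebra ?Z" by (rule Z.superalgebra_commutator_algebra)
  interpret ST: tortkara ?ST by (rule tortkara_free_special_tortkara)
  obtain k where k: "k \<in> superalgebra_hom ?Z ?M"
    and k_gen: "\<And>z. k (?g z) = zin8_eval (Poly_Mapping.single (Gen z) 1)"
    using free_zinbiel_hom[OF zinbiel_zin8 zin8_eval_hom] by blast
  have k_ST: "k \<in> superalgebra_hom ?ST (commutator_algebra ?M)"
    unfolding free_special_tortkara_def Let_def
    by (intro CZ.hom_restrict sub_superalgebra_gens superalgebra_hom_commutator k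
        Z.superalgebra_axioms M.superalgebra_axioms)
  \<comment> \<open>A preimage is preferable to the ideal generated by the two brackets: membership
    and nonmembership are both read off from the eight coordinates of the image.\<close>
  define I where "I = {a \<in> carrier ?ST. k a \<in> zin8_ideal}"
  have I: "graded_ideal ?ST I"
    unfolding I_def
    by (rule graded_ideal_preimage[OF ST.superalgebra_axioms M.superalgebra_commutator_algebra k_ST
          graded_ideal_zin8_ideal])
  let ?T = "quotient_superalgebra ?ST I"
  have gen: "?g z \<in> homog ?ST (xy_parity z)" for z
    using zinbiel_gen_homog[of xy_parity z, where 'k='k] hull_inc[of "?g z" "range ?g"]
    by (simp add: free_special_tortkara_def Let_def restrict_superalgebra_def commutator_algebra_def)
  have gen_c: "?g z \<in> carrier ?ST" for z using gen ST.homog_carrier by blast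
  let ?x = "?g GX" and ?y = "?g GY"
  have k_mult: "k (a \<otimes>\<^bsub>?ST\<^esub> b) = supercommutator ?M (k a) (k b)"
    if "a \<in> carrier ?ST" "b \<in> carrier ?ST" for a b
    using superalgebra_homD(3)[OF k_ST that] by (simp add: commutator_algebra_def)
  have kx: "k ?x = (\<lambda>w. if w = Vx then 1 else 0)" and ky: "k ?y = (\<lambda>w. if w = Vy then 1 else 0)"
    by (simp_all add: k_gen zin8_eval_single fun_eq_iff)
  \<comment> \<open>The images under \<open>k\<close> are -2 yxx, 0 and -8 \<open>Vtop\<close>. The
    last one is nonzero because the characteristic is 0.\<close>
  have xxy: "?x \<otimes>\<^bsub>?ST\<^esub> (?x \<otimes>\<^bsub>?ST\<^esub> ?y) \<in> I"
    and xxx: "(?x \<otimes>\<^bsub>?ST\<^esub> ?x) \<otimes>\<^bsub>?ST\<^esub> ?x \<in> I"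
    and xxyx: "((?x \<otimes>\<^bsub>?ST\<^esub> ?x) \<otimes>\<^bsub>?ST\<^esub> ?y) \<otimes>\<^bsub>?ST\<^esub> ?x \<notin> I"
    by (simp_all add: I_def zin8_ideal_def k_mult gen_c ST.prod_closed all_zin8 supercommutator_zin8 kx ky)
  have "\<not> special ?T"
  proof
    assume "special ?T"
    then obtain A :: "('k, (xy monomial \<Rightarrow>\<^sub>0 'k) set set) superalgebra" and H f where
      A: "zinbiel A" and H: "sub_superalgebra (commutator_algebra A) H" and
      f: "f \<in> superalgebra_iso ?T (restrict_superalgebra (commutator_algebra A) H)"
      unfolding special_def by blast
    interpret A: zinbiel A by fact
    interpret CA: superalgebra "commutator_algebra A" by (rule A.superalgebra_commutator_algebra)
    have f_hom: "f \<in> superalgebra_hom ?T (restrict_superalgebra (commutator_algebra A) H)"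
      and f_inj: "inj_on f (carrier ?T)"
      using f by (auto simp: superalgebra_iso_def bij_betw_def)
    define F where "F a = f (I +>\<^bsub>?ST\<^esub> a)" for a
    have q: "I +>\<^bsub>?ST\<^esub> a \<in> carrier ?T" if "a \<in> carrier ?ST" for a
      using that by (simp add: ST.carrier_quotient[OF I])
    have F_mult: "F (a \<otimes>\<^bsub>?ST\<^esub> b) = supercommutator A (F a) (F b)" if "a \<in> carrier ?ST" "b \<in> carrier ?ST" for a b
      using superalgebra_homD(3)[OF f_hom q[OF that(1)] q[OF that(2)]]
      by (simp add: F_def ST.mult_quotient[OF I that] restrict_superalgebra_def commutator_algebra_def)
    have F_homog: "F a \<in> homog A i" if "a \<in> homog ?ST i" for a i
      using superalgebra_homD(5)[OF f_hom, of "I +>\<^bsub>?ST\<^esub> a" i] that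
      by (simp add: F_def ST.homog_quotient[OF I] restrict_superalgebra_def commutator_algebra_def)
    \<comment> \<open>Homomorphisms are not defined by preservation of zero; it is recovered by
      writing zero as a multiple by the scalar 0.\<close>
    have zero: "0 \<odot>\<^bsub>?ST\<^esub> \<zero>\<^bsub>?ST\<^esub> = \<zero>\<^bsub>?ST\<^esub>" by (simp add: ST.smult_0)
    have F0: "F \<zero>\<^bsub>?ST\<^esub> = \<zero>\<^bsub>A\<^esub>"
      using superalgebra_homD(4)[OF f_hom q[of "\<zero>\<^bsub>?ST\<^esub>"], of 0] A.smult_0[OF A.homog_carrier[OF F_homog[OF ST.zero_homog]]]
      by (simp add: F_def ST.smult_quotient[OF I] zero restrict_superalgebra_def commutator_algebra_def)
    \<comment> \<open>Injectivity of \<open>f\<close> is what gives the direction from left to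
      right. It turns the membership facts about the three brackets into vanishing and nonvanishing
      in A, where they contradict the obstruction.\<close>
    have F_I: "F a = \<zero>\<^bsub>A\<^esub> \<longleftrightarrow> a \<in> I" if "a \<in> carrier ?ST" for a
    proof -
      have "F a = F \<zero>\<^bsub>?ST\<^esub> \<longleftrightarrow> I +>\<^bsub>?ST\<^esub> a = I +>\<^bsub>?ST\<^esub> \<zero>\<^bsub>?ST\<^esub>"
        unfolding F_def using f_inj that by (intro inj_on_eq_iff) (auto intro: q)
      also have "\<dots> \<longleftrightarrow> a \<in> I"
        using ST.coset_eq_iff[OF I that, of "\<zero>\<^bsub>?ST\<^esub>"] that ST.smult_r_null[of "-1"]
        by (simp add: ST.minus_eq_smult)
      finally show ?thesis by (simp add: F0)
    qed
    have "supercommutator A (supercommutator A (supercommutator A (F ?x) (F ?x)) (F ?y)) (F ?x) = \<zero>\<^bsub>A\<^esub>"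
      using xxy xxx gen[of GX] gen[of GY]
      by (intro A.supercommutator_xx_y_x_eq_zero) (simp_all add: F_homog F_I gen_c ST.prod_closed flip: F_mult)
    then show False
      using xxyx by (simp add: F_I gen_c ST.prod_closed flip: F_mult)
  qed
  then have "exceptional ?T"
    using ST.tortkara_quotient[OF I ST.tortkara_axioms] by (simp add: exceptional_def)
  then show ?thesis using I by blast
qed

end
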